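(* Let $p$ be an odd prime. For every $s\ge1$ the rational function $\frac{\bar P_{s+1}(x)}{\bar P_s(x^p)}$ is regular on $\mathfrak{D}$ (its denominator does not vanish there). The sequence $\Big(\frac{\bar P_{s+1}(x)}{\bar P_s(x^p)}\Big)_{s\ge1}$ converges uniformly on $\mathfrak{D}$. The limiting analytic function $f(x)$ equals the ratio $\frac{F(x)}{F(x^p)}$ on the disc $D_{0,1}$. Moreover $|f(x)|_p=1$ for all $x\in\mathfrak{D}$.
   Context: For $s\ge1$, $\bar P_s(x)=\sum_{k=0}^{(p^s-1)/2}\binom{(p^s-1)/2}{k}^2x^k$. The domain is $\mathfrak{D}=\{x\in\mathbb{Z}_p : |\bar P_1(x)|_p=1\}$, and $D_{0,1}=\{x\in\mathbb{Z}_p : |x|_p<1\}$ (which is contained in $\mathfrak{D}$). $F(x)={}_2F_1(\tfrac12,\tfrac12;1;x)=\sum_{k=0}^\infty\binom{-1/2}{k}^2x^k$, a power series convergent on $D_{0,1}$. *)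

theory Defs
  imports
    "HOL-Analysis.Analysis"
    "HOL-Computational_Algebra.Computational_Algebra"
    "Berlekamp_Zassenhaus.Finite_Field"
begin

section \<open>The \<open>p\<close>-adic absolute value on the rationals\<close>

definition padic_abs :: "nat \<Rightarrow> rat \<Rightarrow> real" where
  "padic_abs p q = (if q = 0 then 0 else
     (case quotient_of q of (a, b) \<Rightarrow>
       real p powi (int (multiplicity (int p) b) - int (multiplicity (int p) a))))"

lemma padic_abs_0 [simp]: "padic_abs p 0 = 0"
  by (simp add: padic_abs_def)

lemma padic_abs_frac:
  assumes p: "prime p" and a: "a \<noteq> 0" and b: "b \<noteq> 0"
  shows "padic_abs p (of_int a / of_int b)
    = real p powi (int (multiplicity (int p) b) - int (multiplicity (int p) a))"
proof -
  obtain c d where cd: "quotient_of (of_int a / of_int b) = (c, d)"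
    by (cases "quotient_of (of_int a / of_int b)")
  have d: "d > 0" using quotient_of_denom_pos[OF cd] .
  have eq: "(of_int a / of_int b :: rat) = of_int c / of_int d"
    using quotient_of_div[OF cd] .
  have c: "c \<noteq> 0" using eq a b d by auto
  have "(of_int (a * d) :: rat) = of_int (c * b)"
    using eq b d by (simp add: field_simps)
  then have "a * d = c * b" by (simp only: of_int_eq_iff)
  then have "multiplicity (int p) (a * d) = multiplicity (int p) (c * b)" by simp
  then have "multiplicity (int p) a + multiplicity (int p) d
      = multiplicity (int p) c + multiplicity (int p) b"
    using p a b c d by (simp add: prime_elem_multiplicity_mult_distrib)
  then have "int (multiplicity (int p) d) - int (multiplicity (int p) c)
      = int (multiplicity (int p) b) - int (multiplicity (int p) a)" by linarith
  then show ?thesis using a b cd by (simp add: padic_abs_def)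
qed

lemma rat_frac_cases:
  fixes q :: rat
  obtains a b :: int where "q = of_int a / of_int b" "b > 0"
proof -
  obtain a b where ab: "quotient_of q = (a, b)" by (cases "quotient_of q")
  show ?thesis by (rule that[OF quotient_of_div[OF ab] quotient_of_denom_pos[OF ab]])
qed

lemma padic_abs_nonneg [simp]: "padic_abs p q \<ge> 0"
  by (auto simp: padic_abs_def split: prod.splits)

lemma padic_abs_eq_0_iff:
  assumes "prime p"
  shows "padic_abs p q = 0 \<longleftrightarrow> q = 0"
  using prime_gt_0_nat[OF assms] by (auto simp: padic_abs_def split: prod.splits)

lemma padic_abs_1:
  assumes "prime p"
  shows "padic_abs p 1 = 1"
  using padic_abs_frac[OF assms, of 1 1] by simp

lemma padic_abs_mult:
  assumes p: "prime p"
  shows "padic_abs p (x * y) = padic_abs p x * padic_abs p y"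
proof (cases "x = 0 \<or> y = 0")
  case False
  obtain a b where x: "x = of_int a / of_int b" and b: "b > 0" by (rule rat_frac_cases)
  obtain c d where y: "y = of_int c / of_int d" and d: "d > 0" by (rule rat_frac_cases)
  have a: "a \<noteq> 0" and c: "c \<noteq> 0" using False x y by auto
  have xy: "x * y = of_int (a * c) / of_int (b * d)" by (simp add: x y)
  have "real p \<noteq> 0" using p by auto
  then show ?thesis
    unfolding xy unfolding x y
    using p a b c d
    by (subst (1 2 3) padic_abs_frac)
       (auto simp: prime_elem_multiplicity_mult_distrib power_int_add[symmetric] algebra_simps)
qed auto

lemma padic_abs_minus:
  assumes p: "prime p"
  shows "padic_abs p (- x) = padic_abs p x"
proof -
  have "padic_abs p (-1) = 1"
    using padic_abs_frac[OF p, of "-1" 1] by (simp add: multiplicity_unit_right)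
  then show ?thesis using padic_abs_mult[OF p, of "-1" x] by simp
qed

lemma padic_abs_inverse:
  assumes p: "prime p"
  shows "padic_abs p (inverse x) = inverse (padic_abs p x)"
proof (cases "x = 0")
  case False
  then have "padic_abs p x * padic_abs p (inverse x) = 1"
    by (simp add: padic_abs_mult[OF p, symmetric] padic_abs_1[OF p])
  then show ?thesis by (metis inverse_unique)
qed simp

lemma padic_abs_ultrametric:
  assumes p: "prime p"
  shows "padic_abs p (x + y) \<le> max (padic_abs p x) (padic_abs p y)"
proof (cases "x = 0 \<or> y = 0 \<or> x + y = 0")
  case False
  obtain a b where x: "x = of_int a / of_int b" and b: "b > 0" by (rule rat_frac_cases)
  obtain c d where y: "y = of_int c / of_int d" and d: "d > 0" by (rule rat_frac_cases)
  define e where "e = b * d"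
  define u where "u = a * d"
  define v where "v = c * b"
  have e: "e \<noteq> 0" using b d by (simp add: e_def)
  have xe: "x = of_int u / of_int e" and ye: "y = of_int v / of_int e"
    using b d by (simp_all add: x y e_def u_def v_def)
  have xye: "x + y = of_int (u + v) / of_int e" by (simp add: xe ye add_divide_distrib)
  have u: "u \<noteq> 0" using False xe by auto
  have v: "v \<noteq> 0" using False ye by auto
  have uv: "u + v \<noteq> 0" using False xye by auto
  have pu: "\<not> is_unit (int p)" using p by (metis not_prime_unit prime_int_nat_transfer nat_int
        prime_nat_int_transfer)
  let ?m = "min (multiplicity (int p) u) (multiplicity (int p) v)"
  have "int p ^ ?m dvd u + v"
    by (intro dvd_add multiplicity_dvd') simp_all
  then have m: "?m \<le> multiplicity (int p) (u + v)"
    using uv pu by (intro multiplicity_geI)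
  have p1: "real p \<ge> 1" using prime_gt_1_nat[OF p] by simp
  have "padic_abs p (x + y)
      = real p powi (int (multiplicity (int p) e) - int (multiplicity (int p) (u + v)))"
    unfolding xye by (rule padic_abs_frac[OF p uv e])
  also have "\<dots> \<le> real p powi (int (multiplicity (int p) e) - int ?m)"
    using m p1 by (intro power_int_increasing) simp_all
  also have "\<dots> \<le> max (padic_abs p x) (padic_abs p y)"
    unfolding xe ye padic_abs_frac[OF p u e] padic_abs_frac[OF p v e]
    by (simp add: min_def)
  finally show ?thesis .
qed (auto simp: max_def)

lemma padic_abs_triangle:
  assumes p: "prime p"
  shows "padic_abs p (x + y) \<le> padic_abs p x + padic_abs p y"
  using padic_abs_ultrametric[OF p, of x y] padic_abs_nonneg[of p x] padic_abs_nonneg[of p y]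
  by linarith

lemma padic_abs_triangle_diff:
  assumes p: "prime p"
  shows "\<bar>padic_abs p x - padic_abs p y\<bar> \<le> padic_abs p (x - y)"
  using padic_abs_triangle[OF p, of "x - y" y] padic_abs_triangle[OF p, of "y - x" x]
    padic_abs_minus[OF p, of "x - y"] by simp


section \<open>The field \<open>\<rat>\<^sub>p\<close>\<close>

definition padic_null :: "nat \<Rightarrow> (nat \<Rightarrow> rat) \<Rightarrow> bool" where
  "padic_null p X \<longleftrightarrow> (\<lambda>n. padic_abs p (X n)) \<longlonglongrightarrow> 0"

definition padic_cauchy :: "nat \<Rightarrow> (nat \<Rightarrow> rat) \<Rightarrow> bool" where
  "padic_cauchy p X \<longleftrightarrow> (\<forall>e>0. \<exists>N. \<forall>m\<ge>N. \<forall>n\<ge>N. padic_abs p (X m - X n) < e)"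

definition padic_rel :: "nat \<Rightarrow> (nat \<Rightarrow> rat) \<Rightarrow> (nat \<Rightarrow> rat) \<Rightarrow> bool" where
  "padic_rel p X Y \<longleftrightarrow> padic_cauchy p X \<and> padic_cauchy p Y \<and> padic_null p (\<lambda>n. X n - Y n)"

lemma padic_null_0 [simp]: "padic_null p (\<lambda>n. 0)"
  by (simp add: padic_null_def)

lemma padic_null_bound:
  assumes "padic_null p X" "\<And>n. padic_abs p (Y n) \<le> C * padic_abs p (X n)"
  shows "padic_null p Y"
  unfolding padic_null_def
proof (rule tendsto_sandwich[OF _ _ tendsto_const])
  show "(\<lambda>n. C * padic_abs p (X n)) \<longlonglongrightarrow> 0"
    using tendsto_mult_left[OF assms(1)[unfolded padic_null_def], of C] by simp
qed (use assms(2) in auto)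

lemma padic_null_add:
  assumes p: "prime p" and "padic_null p X" "padic_null p Y"
  shows "padic_null p (\<lambda>n. X n + Y n)"
  unfolding padic_null_def
proof (rule tendsto_sandwich[OF _ _ tendsto_const])
  show "(\<lambda>n. padic_abs p (X n) + padic_abs p (Y n)) \<longlonglongrightarrow> 0"
    using tendsto_add[OF assms(2,3)[unfolded padic_null_def]] by simp
qed (auto intro!: always_eventually padic_abs_triangle[OF p])

lemma padic_null_minus:
  assumes p: "prime p" and "padic_null p X"
  shows "padic_null p (\<lambda>n. - X n)"
  using assms(2) by (simp add: padic_null_def padic_abs_minus[OF p])

lemma padic_null_mult:
  assumes p: "prime p" and "padic_null p X" "\<And>n. padic_abs p (Y n) \<le> C"
  shows "padic_null p (\<lambda>n. X n * Y n)"
  by (rule padic_null_bound[OF assms(2), of _ C])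
     (use assms(3) in \<open>auto simp: padic_abs_mult[OF p] mult.commute[of C] intro!: mult_left_mono\<close>)

lemma padic_cauchy_const [simp]: "padic_cauchy p (\<lambda>n. c)"
  by (simp add: padic_cauchy_def)

lemma padic_cauchy_bounded:
  assumes p: "prime p" and "padic_cauchy p X"
  obtains C where "C > 0" "\<And>n. padic_abs p (X n) \<le> C"
proof -
  obtain N where N: "\<And>n. n \<ge> N \<Longrightarrow> padic_abs p (X n - X N) < 1"
    using assms(2) unfolding padic_cauchy_def by (metis order_refl zero_less_one)
  define C where "C = Max ((\<lambda>n. padic_abs p (X n)) ` {..N}) + 1"
  have le: "padic_abs p (X n) \<le> C - 1" if "n \<le> N" for n
    using that by (auto simp: C_def intro!: Max_ge)
  have "padic_abs p (X n) \<le> C" for n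
  proof (cases "n \<le> N")
    case False
    then have "padic_abs p (X n - X N) < 1" using N by simp
    then show ?thesis
      using le[of N] padic_abs_triangle[OF p, of "X n - X N" "X N"] by simp
  qed (use le[of n] in simp)
  moreover have "C > 0" using le[of 0] padic_abs_nonneg[of p "X 0"] by linarith
  ultimately show ?thesis using that by blast
qed

lemma padic_cauchy_add:
  assumes p: "prime p" and X: "padic_cauchy p X" and Y: "padic_cauchy p Y"
  shows "padic_cauchy p (\<lambda>n. X n + Y n)"
  unfolding padic_cauchy_def
proof (intro allI impI)
  fix e :: real assume "e > 0"
  then obtain M N where
    M: "\<And>m n. m \<ge> M \<Longrightarrow> n \<ge> M \<Longrightarrow> padic_abs p (X m - X n) < e" and
    N: "\<And>m n. m \<ge> N \<Longrightarrow> n \<ge> N \<Longrightarrow> padic_abs p (Y m - Y n) < e"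
    using X Y unfolding padic_cauchy_def by metis
  have "padic_abs p (X m + Y m - (X n + Y n)) < e" if "m \<ge> max M N" "n \<ge> max M N" for m n
    using padic_abs_ultrametric[OF p, of "X m - X n" "Y m - Y n"] M[of m n] N[of m n] that
    by (simp add: add_diff_add)
  then show "\<exists>N. \<forall>m\<ge>N. \<forall>n\<ge>N. padic_abs p (X m + Y m - (X n + Y n)) < e" by blast
qed

lemma padic_cauchy_minus:
  assumes p: "prime p" and X: "padic_cauchy p X"
  shows "padic_cauchy p (\<lambda>n. - X n)"
  using X padic_abs_minus[OF p, of "X _ - X _"]
  unfolding padic_cauchy_def by (metis minus_diff_minus)

lemma padic_cauchy_mult:
  assumes p: "prime p" and X: "padic_cauchy p X" and Y: "padic_cauchy p Y"
  shows "padic_cauchy p (\<lambda>n. X n * Y n)"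
  unfolding padic_cauchy_def
proof (intro allI impI)
  fix e :: real assume e: "e > 0"
  obtain A where A: "A > 0" "\<And>n. padic_abs p (X n) \<le> A" by (rule padic_cauchy_bounded[OF p X]) blast
  obtain B where B: "B > 0" "\<And>n. padic_abs p (Y n) \<le> B" by (rule padic_cauchy_bounded[OF p Y]) blast
  obtain M where M: "\<And>m n. m \<ge> M \<Longrightarrow> n \<ge> M \<Longrightarrow> padic_abs p (X m - X n) < e / B"
    using X e B(1) unfolding padic_cauchy_def by (metis divide_pos_pos)
  obtain N where N: "\<And>m n. m \<ge> N \<Longrightarrow> n \<ge> N \<Longrightarrow> padic_abs p (Y m - Y n) < e / A"
    using Y e A(1) unfolding padic_cauchy_def by (metis divide_pos_pos)
  have "padic_abs p (X m * Y m - X n * Y n) < e" if mn: "m \<ge> max M N" "n \<ge> max M N" for m n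
  proof -
    have "padic_abs p (X m * (Y m - Y n)) \<le> A * padic_abs p (Y m - Y n)"
      unfolding padic_abs_mult[OF p] by (intro mult_right_mono A(2)) simp
    also have "\<dots> < e" using N[of m n] mn A(1) by (simp add: field_simps)
    finally have 1: "padic_abs p (X m * (Y m - Y n)) < e" .
    have "padic_abs p ((X m - X n) * Y n) \<le> padic_abs p (X m - X n) * B"
      unfolding padic_abs_mult[OF p] by (intro mult_left_mono B(2)) simp
    also have "\<dots> < e" using M[of m n] mn B(1) by (simp add: field_simps)
    finally have 2: "padic_abs p ((X m - X n) * Y n) < e" .
    show ?thesis
      using padic_abs_ultrametric[OF p, of "X m * (Y m - Y n)" "(X m - X n) * Y n"] 1 2
      by (simp add: mult_diff_mult)
  qed
  then show "\<exists>N. \<forall>m\<ge>N. \<forall>n\<ge>N. padic_abs p (X m * Y m - X n * Y n) < e" by blast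
qed

lemma padic_cauchy_not_null:
  assumes p: "prime p" and X: "padic_cauchy p X" and nz: "\<not> padic_null p X"
  obtains r N where "r > 0" "\<And>n. n \<ge> N \<Longrightarrow> padic_abs p (X n) \<ge> r"
proof -
  obtain r where r: "r > 0" and inf: "\<And>N. \<exists>n\<ge>N. padic_abs p (X n) \<ge> r"
    using nz unfolding padic_null_def LIMSEQ_iff by (auto simp: not_less)
  obtain N where N: "\<And>m n. m \<ge> N \<Longrightarrow> n \<ge> N \<Longrightarrow> padic_abs p (X m - X n) < r"
    using X r unfolding padic_cauchy_def by metis
  obtain k where k: "k \<ge> N" "padic_abs p (X k) \<ge> r" using inf by blast
  have "padic_abs p (X n) \<ge> r" if "n \<ge> N" for n
    using padic_abs_ultrametric[OF p, of "X k - X n" "X n"] N[of k n] k that by auto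
  then show ?thesis using that r by blast
qed

lemma inverse_diff_padic_bound:
  assumes p: "prime p" and r: "r > 0" "s > 0"
    and x: "padic_abs p x \<ge> r" and y: "padic_abs p y \<ge> s"
  shows "padic_abs p (inverse x - inverse y) \<le> padic_abs p (x - y) / (r * s)"
proof -
  have nz: "x \<noteq> 0" "y \<noteq> 0" using assms by auto
  have "padic_abs p (inverse x - inverse y)
      = padic_abs p (x - y) * (inverse (padic_abs p x) * inverse (padic_abs p y))"
    using nz by (simp add: inverse_diff_inverse padic_abs_minus[OF p] padic_abs_mult[OF p]
        padic_abs_inverse[OF p])
  also have "\<dots> \<le> padic_abs p (x - y) * (inverse r * inverse s)"
    using assms by (intro mult_left_mono mult_mono le_imp_inverse_le) auto
  finally show ?thesis by (simp add: field_simps)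
qed

lemma padic_cauchy_inverse:
  assumes p: "prime p" and X: "padic_cauchy p X" and nz: "\<not> padic_null p X"
  shows "padic_cauchy p (\<lambda>n. inverse (X n))"
  unfolding padic_cauchy_def
proof (intro allI impI)
  fix e :: real assume e: "e > 0"
  obtain r M where r: "r > 0" and M: "\<And>n. n \<ge> M \<Longrightarrow> padic_abs p (X n) \<ge> r"
    by (rule padic_cauchy_not_null[OF p X nz]) blast
  have "e * (r * r) > 0" using e r by simp
  then obtain N where N: "\<And>m n. m \<ge> N \<Longrightarrow> n \<ge> N \<Longrightarrow> padic_abs p (X m - X n) < e * (r * r)"
    using X unfolding padic_cauchy_def by metis
  have "padic_abs p (inverse (X m) - inverse (X n)) < e"
    if mn: "m \<ge> max M N" "n \<ge> max M N" for m n
  proof -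
    have "padic_abs p (inverse (X m) - inverse (X n)) \<le> padic_abs p (X m - X n) / (r * r)"
      using mn by (intro inverse_diff_padic_bound[OF p r r] M) simp_all
    also have "\<dots> < e" using N[of m n] mn r by (simp add: divide_less_eq)
    finally show ?thesis .
  qed
  then show "\<exists>N. \<forall>m\<ge>N. \<forall>n\<ge>N. padic_abs p (inverse (X m) - inverse (X n)) < e" by blast
qed

lemma padic_null_inverse_diff:
  assumes p: "prime p" and X: "padic_cauchy p X" "\<not> padic_null p X"
    and Y: "padic_cauchy p Y" "\<not> padic_null p Y" and XY: "padic_null p (\<lambda>n. X n - Y n)"
  shows "padic_null p (\<lambda>n. inverse (X n) - inverse (Y n))"
proof -
  obtain r M where r: "r > 0" and M: "\<And>n. n \<ge> M \<Longrightarrow> padic_abs p (X n) \<ge> r"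
    by (rule padic_cauchy_not_null[OF p X]) blast
  obtain s N where s: "s > 0" and N: "\<And>n. n \<ge> N \<Longrightarrow> padic_abs p (Y n) \<ge> s"
    by (rule padic_cauchy_not_null[OF p Y]) blast
  show ?thesis
    unfolding padic_null_def
  proof (rule tendsto_sandwich[OF _ _ tendsto_const])
    show "(\<lambda>n. padic_abs p (X n - Y n) / (r * s)) \<longlonglongrightarrow> 0"
      using tendsto_divide_zero[OF XY[unfolded padic_null_def]] .
    show "\<forall>\<^sub>F n in sequentially. padic_abs p (inverse (X n) - inverse (Y n))
        \<le> padic_abs p (X n - Y n) / (r * s)"
      using eventually_ge_at_top[of "max M N"]
      by eventually_elim (intro inverse_diff_padic_bound[OF p r s] M N; simp)
  qed simp
qed

lemma padic_rel_null_iff: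
  assumes p: "prime p" and "padic_rel p X Y"
  shows "padic_null p X \<longleftrightarrow> padic_null p Y"
proof -
  have XY: "padic_null p (\<lambda>n. X n - Y n)" using assms by (simp add: padic_rel_def)
  show ?thesis
    using padic_null_add[OF p _ XY, of Y] padic_null_add[OF p _ padic_null_minus[OF p XY], of X]
    by auto
qed

lemma padic_rel_refl: "padic_cauchy p X \<Longrightarrow> padic_rel p X X"
  by (simp add: padic_rel_def)

lemma part_equivp_padic_rel:
  assumes p: "prime p"
  shows "part_equivp (padic_rel p)"
proof (rule part_equivpI)
  show "\<exists>X. padic_rel p X X" by (intro exI[of _ "\<lambda>_. 0"] padic_rel_refl) simp
  show "symp (padic_rel p)"
    by (auto simp: symp_def padic_rel_def dest: padic_null_minus[OF p])
  show "transp (padic_rel p)"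
    by (auto simp: transp_def padic_rel_def dest: padic_null_add[OF p])
qed

lemma padic_abs_convergent:
  assumes p: "prime p" and X: "padic_cauchy p X"
  shows "convergent (\<lambda>n. padic_abs p (X n))"
proof (rule real_Cauchy_convergent, rule CauchyI)
  fix e :: real assume "e > 0"
  then obtain N where "\<And>m n. m \<ge> N \<Longrightarrow> n \<ge> N \<Longrightarrow> padic_abs p (X m - X n) < e"
    using X unfolding padic_cauchy_def by metis
  then show "\<exists>M. \<forall>m\<ge>M. \<forall>n\<ge>M. norm (padic_abs p (X m) - padic_abs p (X n)) < e"
    by (metis order_le_less_trans padic_abs_triangle_diff[OF p] real_norm_def)
qed

lemma padic_abs_lim_cong:
  assumes p: "prime p" and XY: "padic_rel p X Y"
  shows "lim (\<lambda>n. padic_abs p (X n)) = lim (\<lambda>n. padic_abs p (Y n))"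
proof -
  have "(\<lambda>n. padic_abs p (X n) - padic_abs p (Y n)) \<longlonglongrightarrow> 0"
    by (rule Lim_null_comparison[of _ "\<lambda>n. padic_abs p (X n - Y n)"])
       (use XY in \<open>auto simp: padic_abs_triangle_diff[OF p] padic_rel_def padic_null_def\<close>)
  moreover have "(\<lambda>n. padic_abs p (Y n)) \<longlonglongrightarrow> lim (\<lambda>n. padic_abs p (Y n))"
    using padic_abs_convergent[OF p] XY
    by (auto simp: padic_rel_def convergent_LIMSEQ_iff)
  ultimately have "(\<lambda>n. padic_abs p (X n)) \<longlonglongrightarrow> lim (\<lambda>n. padic_abs p (Y n))"
    using tendsto_add by fastforce
  then show ?thesis by (rule limI)
qed

text \<open>
  The type \<open>'p padic\<close> is the field \<open>\<rat>\<^sub>p\<close> for \<open>p = CARD('p)\<close>, constructed as the completion of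
  the rationals with respect to the \<open>p\<close>-adic absolute value: Cauchy sequences modulo null sequences.
\<close>

typedef (overloaded) 'p padic =
  "{C. \<exists>X. padic_rel CARD('p::prime_card) X X \<and> C = Collect (padic_rel CARD('p) X)}"
  by (auto intro!: exI[of _ "\<lambda>_. 0"] padic_rel_refl)

definition Padic :: "(nat \<Rightarrow> rat) \<Rightarrow> 'p::prime_card padic" where
  "Padic X = Abs_padic (Collect (padic_rel CARD('p) X))"

definition rep_padic :: "'p::prime_card padic \<Rightarrow> nat \<Rightarrow> rat" where
  "rep_padic x = (SOME X. X \<in> Rep_padic x)"

definition cr_padic :: "(nat \<Rightarrow> rat) \<Rightarrow> 'p::prime_card padic \<Rightarrow> bool" where
  "cr_padic X x \<longleftrightarrow> padic_rel CARD('p) X X \<and> Padic X = x"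

lemma Quotient3_padic:
  "Quotient3 (padic_rel CARD('p::prime_card)) (Padic :: _ \<Rightarrow> 'p padic) rep_padic"
proof -
  have q: "quot_type (padic_rel CARD('p)) (Abs_padic :: _ \<Rightarrow> 'p padic) Rep_padic"
  proof
    show "part_equivp (padic_rel CARD('p))" by (rule part_equivp_padic_rel[OF prime_card])
    show "\<exists>X. padic_rel CARD('p) X X \<and> Rep_padic y = Collect (padic_rel CARD('p) X)"
      for y :: "'p padic"
      using Rep_padic[of y] by simp
  qed (auto simp: Rep_padic_inverse Rep_padic_inject intro!: Abs_padic_inverse)
  have "Padic = (\<lambda>X. Abs_padic (Collect (padic_rel CARD('p) X)) :: 'p padic)"
    "rep_padic = (\<lambda>x :: 'p padic. SOME X. X \<in> Rep_padic x)"
    by (simp_all add: Padic_def rep_padic_def fun_eq_iff)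
  then show ?thesis
    using quot_type.Quotient[OF q]
    unfolding quot_type.abs_def[OF q, abs_def] quot_type.rep_def[OF q, abs_def] by simp
qed

lemma Quotient_padic:
  "Quotient (padic_rel CARD('p::prime_card)) Padic rep_padic (cr_padic :: _ \<Rightarrow> 'p padic \<Rightarrow> _)"
proof -
  have "(cr_padic :: _ \<Rightarrow> 'p padic \<Rightarrow> _) = (\<lambda>X x. padic_rel CARD('p) X X \<and> Padic X = x)"
    by (simp add: cr_padic_def fun_eq_iff)
  then show ?thesis
    using Quotient3_to_Quotient[OF Quotient3_padic[where 'p = 'p] reflexive]
    by (simp only:)
qed

setup_lifting Quotient_padic

lemma padic_of_seq_induct [case_names Padic]:
  fixes x :: "'p::prime_card padic"
  assumes "\<And>X. padic_cauchy CARD('p) X \<Longrightarrow> P (Padic X)"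
  shows "P x"
  using assms[of "rep_padic x"] Quotient3_abs_rep[OF Quotient3_padic, of x]
    Quotient3_rep_reflp[OF Quotient3_padic, of x] by (simp add: padic_rel_def)

instantiation padic :: (prime_card) field
begin

lift_definition zero_padic :: "'a padic" is "\<lambda>n. 0"
  by (simp add: padic_rel_refl)

lift_definition one_padic :: "'a padic" is "\<lambda>n. 1"
  by (simp add: padic_rel_refl)

lift_definition plus_padic :: "'a padic \<Rightarrow> 'a padic \<Rightarrow> 'a padic" is "\<lambda>X Y n. X n + Y n"
  using prime_card[where 'a='a]
  by (auto simp: padic_rel_def add_diff_add intro: padic_cauchy_add padic_null_add)

lift_definition uminus_padic :: "'a padic \<Rightarrow> 'a padic" is "\<lambda>X n. - X n"
  using prime_card[where 'a='a]
  by (auto simp: padic_rel_def intro: padic_cauchy_minus dest: padic_null_minus)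

lift_definition times_padic :: "'a padic \<Rightarrow> 'a padic \<Rightarrow> 'a padic" is "\<lambda>X Y n. X n * Y n"
proof -
  fix X X' Y Y'
  assume X: "padic_rel CARD('a) X X'" and Y: "padic_rel CARD('a) Y Y'"
  note p = prime_card[where 'a='a]
  obtain A where A: "\<And>n. padic_abs CARD('a) (X n) \<le> A"
    using padic_cauchy_bounded[OF p] X unfolding padic_rel_def by metis
  obtain B where B: "\<And>n. padic_abs CARD('a) (Y' n) \<le> B"
    using padic_cauchy_bounded[OF p] Y unfolding padic_rel_def by metis
  have "padic_null CARD('a) (\<lambda>n. (Y n - Y' n) * X n + (X n - X' n) * Y' n)"
    using X Y A B by (intro padic_null_add[OF p] padic_null_mult[OF p]) (auto simp: padic_rel_def)
  then show "padic_rel CARD('a) (\<lambda>n. X n * Y n) (\<lambda>n. X' n * Y' n)"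
    using X Y by (simp add: padic_rel_def padic_cauchy_mult[OF p] mult_diff_mult mult.commute)
qed

lift_definition inverse_padic :: "'a padic \<Rightarrow> 'a padic"
  is "\<lambda>X. if padic_null CARD('a) X then (\<lambda>n. 0) else (\<lambda>n. inverse (X n))"
proof -
  fix X Y
  assume XY: "padic_rel CARD('a) X Y"
  note p = prime_card[where 'a='a]
  show "padic_rel CARD('a)
      (if padic_null CARD('a) X then (\<lambda>n. 0) else (\<lambda>n. inverse (X n)))
      (if padic_null CARD('a) Y then (\<lambda>n. 0) else (\<lambda>n. inverse (Y n)))"
    using XY padic_rel_null_iff[OF p XY]
    by (auto simp: padic_rel_def intro: padic_cauchy_inverse[OF p] padic_null_inverse_diff[OF p])
qed

definition minus_padic :: "'a padic \<Rightarrow> 'a padic \<Rightarrow> 'a padic" where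
  "x - y = x + - y" for x y :: "'a padic"

definition divide_padic :: "'a padic \<Rightarrow> 'a padic \<Rightarrow> 'a padic" where
  "x div y = x * inverse y" for x y :: "'a padic"

instance
proof
  note p = prime_card[where 'a='a]
  note intros = padic_rel_refl padic_cauchy_add[OF p] padic_cauchy_mult[OF p]
    padic_cauchy_minus[OF p]
  fix a b c :: "'a padic"
  show "a + b = b + a"
    by transfer (auto simp: padic_rel_def add.commute intro: intros)
  show "a + b + c = a + (b + c)"
    by transfer (auto simp: padic_rel_def add.assoc intro: intros)
  show "0 + a = a"
    by transfer (auto simp: padic_rel_def)
  show "- a + a = 0"
    by transfer (auto simp: padic_rel_def)
  show "a - b = a + - b"
    by (rule minus_padic_def)
  show "a * b = b * a"
    by transfer (auto simp: padic_rel_def mult.commute intro: intros)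
  show "a * b * c = a * (b * c)"
    by transfer (auto simp: padic_rel_def mult.assoc intro: intros)
  show "1 * a = a"
    by transfer (auto simp: padic_rel_def)
  show "(a + b) * c = a * c + b * c"
    by transfer (auto simp: padic_rel_def distrib_right intro!: intros)
  show "(0 :: 'a padic) \<noteq> 1"
    by transfer (simp add: padic_rel_def padic_null_def padic_abs_1[OF p] padic_abs_minus[OF p]
        LIMSEQ_const_iff)
  show "inverse (0 :: 'a padic) = 0"
    by transfer (simp add: padic_rel_def)
  show "a div b = a * inverse b"
    by (rule divide_padic_def)
  show "inverse a * a = 1" if "a \<noteq> 0"
    using that
  proof transfer
    fix X assume XX: "padic_rel CARD('a) X X" and "\<not> padic_rel CARD('a) X (\<lambda>n. 0)"
    then have X: "padic_cauchy CARD('a) X" and nz: "\<not> padic_null CARD('a) X"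
      by (simp_all add: padic_rel_def)
    obtain r N where r: "r > 0" "\<And>n. n \<ge> N \<Longrightarrow> padic_abs CARD('a) (X n) \<ge> r"
      by (rule padic_cauchy_not_null[OF p X nz]) blast
    have "padic_abs CARD('a) (inverse (X n) * X n - 1) = 0" if "n \<ge> N" for n
    proof -
      have "X n \<noteq> 0" using r(2)[OF that] r(1) by auto
      then show ?thesis by simp
    qed
    then have "padic_null CARD('a) (\<lambda>n. inverse (X n) * X n - 1)"
      unfolding padic_null_def
      by (intro tendsto_eventually eventually_sequentiallyI[of N])
    then show "padic_rel CARD('a)
        (\<lambda>n. (if padic_null CARD('a) X then \<lambda>n. 0 else (\<lambda>n. inverse (X n))) n * X n) (\<lambda>n. 1)"
      using nz X by (simp add: padic_rel_def padic_cauchy_mult[OF p] padic_cauchy_inverse[OF p])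
  qed
qed

end

text \<open>
  The library constrains \<open>norm\<close> to real normed vector spaces, hence a separate constant for the
  extension of the \<open>p\<close>-adic absolute value to \<open>\<rat>\<^sub>p\<close>.
\<close>

lift_definition padic_norm :: "'p::prime_card padic \<Rightarrow> real"
  is "\<lambda>X. lim (\<lambda>n. padic_abs CARD('p) (X n))"
  by (rule padic_abs_lim_cong[OF prime_card])

lemma padic_norm_tendsto:
  assumes "padic_cauchy CARD('p::prime_card) X"
  shows "(\<lambda>n. padic_abs CARD('p) (X n)) \<longlonglongrightarrow> padic_norm (Padic X :: 'p padic)"
proof -
  have "padic_norm (Padic X :: 'p padic) = lim (\<lambda>n. padic_abs CARD('p) (X n))"
    using padic_norm.abs_eq[OF padic_rel_refl[OF assms]] .
  then show ?thesis
    using padic_abs_convergent[OF prime_card assms] by (simp add: convergent_LIMSEQ_iff)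
qed

lemma padic_norm_nonneg [simp]: "padic_norm (x :: 'p::prime_card padic) \<ge> 0"
proof (induct x rule: padic_of_seq_induct)
  case (Padic X)
  show ?case by (rule LIMSEQ_le_const[OF padic_norm_tendsto[OF Padic]]) simp
qed

lemma padic_norm_eq_0_iff [simp]: "padic_norm x = 0 \<longleftrightarrow> x = (0 :: 'p::prime_card padic)"
proof (induct x rule: padic_of_seq_induct)
  case (Padic X)
  have "padic_norm (Padic X :: 'p padic) = 0 \<longleftrightarrow> padic_null CARD('p) X"
    unfolding padic_null_def using padic_norm_tendsto[OF Padic] LIMSEQ_unique by metis
  also have "\<dots> \<longleftrightarrow> padic_rel CARD('p) X (\<lambda>n. 0)"
    using Padic by (simp add: padic_rel_def)
  also have "\<dots> \<longleftrightarrow> (Padic X :: 'p padic) = 0"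
    unfolding zero_padic_def
    using Quotient3_rel[OF Quotient3_padic] padic_rel_refl[OF Padic]
      padic_rel_refl[OF padic_cauchy_const] by metis
  finally show ?case .
qed

lemma padic_norm_mult: "padic_norm (x * y) = padic_norm x * padic_norm (y :: 'p::prime_card padic)"
proof (induct x rule: padic_of_seq_induct)
  case X: (Padic X)
  show ?case
  proof (induct y rule: padic_of_seq_induct)
    case Y: (Padic Y)
    have XY: "Padic X * Padic Y = (Padic (\<lambda>n. X n * Y n) :: 'p padic)"
      by (rule times_padic.abs_eq; intro padic_rel_refl X Y)
    show ?case
      unfolding XY
      using padic_norm_tendsto[OF padic_cauchy_mult[OF prime_card X Y]]
        tendsto_mult[OF padic_norm_tendsto[OF X] padic_norm_tendsto[OF Y]]
      by (simp add: padic_abs_mult[OF prime_card] LIMSEQ_unique)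
  qed
qed

lemma padic_norm_ultrametric:
  "padic_norm (x + y) \<le> max (padic_norm x) (padic_norm (y :: 'p::prime_card padic))"
proof (induct x rule: padic_of_seq_induct)
  case X: (Padic X)
  show ?case
  proof (induct y rule: padic_of_seq_induct)
    case Y: (Padic Y)
    have XY: "Padic X + Padic Y = (Padic (\<lambda>n. X n + Y n) :: 'p padic)"
      by (rule plus_padic.abs_eq; intro padic_rel_refl X Y)
    show ?case
      unfolding XY
      using padic_norm_tendsto[OF padic_cauchy_add[OF prime_card X Y]]
        tendsto_max[OF padic_norm_tendsto[OF X] padic_norm_tendsto[OF Y]]
      by (rule LIMSEQ_le) (auto intro: padic_abs_ultrametric[OF prime_card])
  qed
qed

lemma padic_norm_1 [simp]: "padic_norm (1 :: 'p::prime_card padic) = 1"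
proof -
  have "padic_norm (1 :: 'p padic) * padic_norm (1 :: 'p padic) = padic_norm (1 :: 'p padic)"
    by (simp add: padic_norm_mult[symmetric])
  moreover have "padic_norm (1 :: 'p padic) \<noteq> 0"
    by simp
  ultimately show ?thesis by simp
qed

lemma padic_norm_minus [simp]: "padic_norm (- x) = padic_norm (x :: 'p::prime_card padic)"
proof -
  have "padic_norm (-1 :: 'p padic) * padic_norm (-1 :: 'p padic) = 1"
    by (simp add: padic_norm_mult[symmetric])
  then have "padic_norm (-1 :: 'p padic) = 1"
    using padic_norm_nonneg[of "-1 :: 'p padic"] by (metis abs_of_nonneg power2_eq_1_iff
        power2_eq_square abs_1 abs_minus)
  then show ?thesis using padic_norm_mult[of "-1" x] by simp
qed

instantiation padic :: (prime_card) metric_space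
begin

definition dist_padic :: "'a padic \<Rightarrow> 'a padic \<Rightarrow> real" where
  "dist_padic x y = padic_norm (x - y)"

definition uniformity_padic :: "('a padic \<times> 'a padic) filter" where
  "uniformity_padic = (INF e\<in>{0<..}. principal {(x, y). dist x y < e})"

definition open_padic :: "'a padic set \<Rightarrow> bool" where
  "open_padic U \<longleftrightarrow> (\<forall>x\<in>U. eventually (\<lambda>(x', y). x' = x \<longrightarrow> y \<in> U) uniformity)"

instance
proof
  fix x y z :: "'a padic"
  show "dist x y = 0 \<longleftrightarrow> x = y"
    by (simp add: dist_padic_def)
  have "padic_norm (x - y) \<le> max (padic_norm (x - z)) (padic_norm (y - z))"
    using padic_norm_ultrametric[of "x - z" "z - y"] padic_norm_minus[of "y - z"] by simp
  then show "dist x y \<le> dist x z + dist y z"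
    using padic_norm_nonneg[of "x - z"] padic_norm_nonneg[of "y - z"]
    unfolding dist_padic_def by linarith
qed (simp_all add: uniformity_padic_def open_padic_def)

end

lemma of_nat_padic: "(of_nat k :: 'p::prime_card padic) = Padic (\<lambda>n. of_nat k)"
proof (induct k)
  case 0
  show ?case by (simp add: zero_padic_def)
next
  case (Suc k)
  have "(Padic (\<lambda>n. 1) + Padic (\<lambda>n. of_nat k) :: 'p padic) = Padic (\<lambda>n. 1 + of_nat k)"
    by (rule plus_padic.abs_eq; intro padic_rel_refl padic_cauchy_const)
  then show ?case using Suc by (simp add: one_padic_def)
qed

lemma padic_norm_of_nat: "padic_norm (of_nat k :: 'p::prime_card padic) = padic_abs CARD('p) (of_nat k)"
  using padic_norm_tendsto[OF padic_cauchy_const, where 'p='p, of "of_nat k"]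
  by (simp add: of_nat_padic LIMSEQ_const_iff)

instance padic :: (prime_card) field_char_0
proof
  have *: "(of_nat k :: 'a padic) \<noteq> 0" if "k > 0" for k
    using that by (simp add: padic_norm_of_nat padic_abs_eq_0_iff[OF prime_card]
        flip: padic_norm_eq_0_iff)
  show "inj (of_nat :: nat \<Rightarrow> 'a padic)"
  proof (rule injI)
    fix m n :: nat
    assume eq: "(of_nat m :: 'a padic) = of_nat n"
    show "m = n"
    proof (rule ccontr)
      assume "m \<noteq> n"
      then consider "m < n" | "n < m" by linarith
      then show False
      proof cases
        case 1 then show ?thesis using *[of "n - m"] eq by (simp add: of_nat_diff)
      next
        case 2 then show ?thesis using *[of "m - n"] eq by (simp add: of_nat_diff)
      qed
    qed
  qed
qed

text \<open>\<open>\<int>\<^sub>p\<close> is the closed unit ball of \<open>\<rat>\<^sub>p\<close>.\<close>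

definition padic_ints :: "'p::prime_card padic set" where
  "padic_ints = {x. padic_norm x \<le> 1}"

text \<open>Analyticity on an (open) subset of \<open>\<rat>\<^sub>p\<close>: local expansion into convergent power series.\<close>

definition padic_analytic_on :: "('p::prime_card padic \<Rightarrow> 'p padic) \<Rightarrow> 'p padic set \<Rightarrow> bool" where
  "padic_analytic_on f U \<longleftrightarrow> (\<forall>a\<in>U. \<exists>r>0. \<exists>c. ball a r \<subseteq> U \<and>
     (\<forall>x\<in>ball a r. (\<lambda>k. c k * (x - a) ^ k) sums f x))"


section \<open>Polynomial approximations of the hypergeometric series\<close>

definition Pbar :: "nat \<Rightarrow> nat \<Rightarrow> 'a::comm_semiring_1 poly" where
  "Pbar p s = (\<Sum>k\<le>(p ^ s - 1) div 2. Polynomial.monom (of_nat (((p ^ s - 1) div 2 choose k)\<^sup>2)) k)"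

definition domD :: "'p::prime_card padic set" where
  "domD = {x \<in> padic_ints. padic_norm (poly (Pbar CARD('p) 1) x) = 1}"

definition D01 :: "'p::prime_card padic set" where
  "D01 = {x \<in> padic_ints. padic_norm x < 1}"

definition hyperF :: "'p::prime_card padic \<Rightarrow> 'p padic" where
  "hyperF x = (\<Sum>k. ((- 1 / 2) gchoose k)\<^sup>2 * x ^ k)"

end

theory Submission
  imports Defs
begin

text \<open>
  Write \<open>P s\<close> for the truncation, \<open>n s = (p ^ s - 1) / 2\<close>, and think of \<open>P s x\<close> as the coefficient of
  \<open>t ^ n s\<close> in \<open>((1 + t) * (t + x)) ^ n s\<close>. The polynomials
  \<open>L j = (1 + t ^ (p ^ j)) * (t ^ (p ^ j) + x ^ (p ^ j))\<close> satisfy \<open>L (j + 1) \<equiv> L j ^ p\<close> modulo \<open>p\<close>, and the base-\<open>p\<close>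
  digits of \<open>n s\<close> are all the same. Comparing powers of \<open>L 0\<close> with powers of the \<open>L (j + 1)\<close> produces
  ghost terms: \<open>L 0 ^ n (s + 1) = (\<Sum>j\<le>s. V j * L (j + 1) ^ n (s - j))\<close> with \<open>p ^ j\<close> dividing \<open>V j\<close>
  (\<open>ghost_dvd\<close>). The degree of \<open>V j\<close> in \<open>t\<close> is below \<open>p ^ (j + 1)\<close>, so taking the coefficient of
  \<open>t ^ n (s + 1)\<close> gives
  \<open>P (s + 1) x = (\<Sum>j\<le>s. a j * P (s - j) (x ^ (p ^ (j + 1))))\<close> with \<open>p ^ j\<close> dividing \<open>a j\<close>
  (\<open>Pbar_ghost_expansion\<close>). Such expansions imply, purely formally, the Dwork congruence
  \<open>P (s + 2) x * P s (x ^ p) \<equiv> P (s + 1) x * P (s + 1) (x ^ p)\<close> modulo \<open>p ^ (s + 1)\<close>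
  as polynomials with integer coefficients
  (\<open>dwork_congruence_of_ghost_expansion\<close>, \<open>Pbar_dwork_congruence\<close>).

  The domain is stable under \<open>x \<mapsto> x ^ p\<close>, and the congruence modulo \<open>p\<close> shows inductively that all \<open>P s\<close>
  take unit values there (\<open>padic_norm_Pbar_eq_1\<close>). This gives the regularity of the ratios and
  the norm of the limit; dividing the Dwork congruence by its denominators shows that consecutive
  ratios differ by \<open>p ^ (s + 1)\<close> times a function with integral values, hence uniform convergence, the
  \<open>p\<close>-adic numbers being complete. Around each point of the domain the ratios expand on the open unit disc into
  power series with integral coefficients, and consecutive expansions differ by \<open>p ^ (s + 1)\<close> times a
  series of this kind; therefore the limit is analytic (\<open>integrally_analytic_at_limit\<close>).

  On the disc \<open>D01\<close> the ratio of limits can be computed: \<open>n s\<close> tends to \<open>-1/2\<close>, so the coefficients of \<open>P s\<close> tend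
  to those of the hypergeometric series, and dominated convergence gives
  \<open>P s x \<longlonglongrightarrow> hyperF x\<close> (\<open>Pbar_tendsto_hyperF\<close>).
\<close>

section \<open>Ghost terms of a Frobenius-compatible sequence\<close>

lemma prime_dvd_add_power_diff:
  fixes a b :: "'a::comm_ring_1"
  assumes p: "prime p"
  shows "of_nat p dvd (a + b) ^ p - (a ^ p + b ^ p)"
proof -
  have p0: "p > 0" using p prime_gt_0_nat by blast
  have split: "{..p} = insert 0 (insert p {0<..<p})" using p0 by auto
  have "(a + b) ^ p = a ^ p + b ^ p + (\<Sum>k\<in>{0<..<p}. of_nat (p choose k) * a ^ k * b ^ (p - k))"
    unfolding binomial_ring split using p0 by (simp add: algebra_simps)
  moreover have "of_nat p dvd (\<Sum>k\<in>{0<..<p}. of_nat (p choose k) * a ^ k * b ^ (p - k))"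
  proof (intro dvd_sum dvd_mult2)
    fix k assume "k \<in> {0<..<p}"
    then have "p dvd (p choose k)" by (intro dvd_choose_prime p) auto
    then show "(of_nat p :: 'a) dvd of_nat (p choose k)" by (auto simp: dvd_def)
  qed
  ultimately show ?thesis by simp
qed

lemma dvd_power_diff:
  fixes a b c :: "'a::comm_ring_1"
  assumes "c dvd a - b"
  shows "c dvd a ^ n - b ^ n"
  unfolding power_diff_sumr2 using assms by (rule dvd_mult2)

text \<open>
  Each \<open>p\<close>-th power gains one factor \<open>p\<close>: in
  \<open>a ^ p - b ^ p = (a - b) * (\<Sum>i<p. b ^ (p - 1 - i) * a ^ i)\<close> the second factor becomes
  \<open>p * b ^ (p - 1)\<close>, hence \<open>0\<close>, modulo \<open>p\<close> because \<open>a\<close> and \<open>b\<close> agree there.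
\<close>

lemma dvd_diff_power_lift:
  fixes a b :: "'a::comm_ring_1"
  assumes "of_nat p ^ Suc m dvd a - b"
  shows "of_nat p ^ Suc (Suc m) dvd a ^ p - b ^ p"
proof (cases p)
  case 0
  then show ?thesis by simp
next
  case (Suc q)
  have pd: "of_nat p dvd a - b" using power_le_dvd[OF assms, of 1] by simp
  have "of_nat p dvd a ^ i - b ^ i" for i
    using pd by (rule dvd_power_diff)
  then have "of_nat p dvd (\<Sum>i<p. b ^ (p - Suc i) * (a ^ i - b ^ i))"
    by (intro dvd_sum dvd_mult) auto
  moreover have "(\<Sum>i<p. b ^ (p - Suc i) * (a ^ i - b ^ i))
      = (\<Sum>i<p. b ^ (p - Suc i) * a ^ i) - of_nat p * b ^ q"
  proof -
    have "(\<Sum>i<p. b ^ (p - Suc i) * b ^ i) = (\<Sum>i<p. b ^ q)"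
      by (intro sum.cong) (auto simp: Suc simp flip: power_add)
    then show ?thesis by (simp add: right_diff_distrib sum_subtractf)
  qed
  ultimately have "of_nat p dvd (\<Sum>i<p. b ^ (p - Suc i) * a ^ i)"
    by (simp add: dvd_diff_left_iff)
  then have "of_nat p ^ Suc m * of_nat p dvd (a - b) * (\<Sum>i<p. b ^ (p - Suc i) * a ^ i)"
    by (rule mult_dvd_mono[OF assms])
  then show ?thesis by (simp add: power_diff_sumr2 mult.commute mult.left_commute)
qed

text \<open>
  The ghost terms are defined so that
  \<open>L 0 ^ n (s + 1) = (\<Sum>j\<le>s. ghost L n j * L (j + 1) ^ n (s - j))\<close> when \<open>n 0 = 0\<close>. They
  are the corrections needed to write powers of \<open>L 0\<close> through powers of its Frobenius twists \<open>L (j + 1)\<close>.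
\<close>

fun ghost :: "(nat \<Rightarrow> 'a::comm_ring_1) \<Rightarrow> (nat \<Rightarrow> nat) \<Rightarrow> nat \<Rightarrow> 'a" where
  "ghost L n s = L 0 ^ n (Suc s) - (\<Sum>j<s. ghost L n j * L (Suc j) ^ n (s - j))"

declare ghost.simps [simp del]

lemma frobenius_lift_power_dvd:
  fixes L :: "nat \<Rightarrow> 'a::comm_ring_1"
  assumes "\<And>j. of_nat p dvd L j ^ p - L (Suc j)"
  shows "of_nat p ^ Suc k dvd L j ^ p ^ Suc k - L (Suc j) ^ p ^ k"
proof (induction k)
  case 0
  then show ?case using assms by simp
next
  case (Suc k)
  then show ?case
    using dvd_diff_power_lift[OF Suc.IH] by (simp add: power_mult[symmetric] mult_ac)
qed

text \<open>
  The first twist, from \<open>L 0\<close> to \<open>L 1\<close>, is exact modulo \<open>p ^ (k + 1)\<close>. Every further twist starts from a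
  power with exponent smaller by a factor \<open>p\<close>, and is exact to one power of \<open>p\<close> less.
\<close>

lemma frobenius_lift_power_dvd_iterated:
  fixes L :: "nat \<Rightarrow> 'a::comm_ring_1"
  assumes L: "\<And>j. of_nat p dvd L j ^ p - L (Suc j)" and "j \<le> k"
  shows "of_nat p ^ Suc (k - j) dvd L 0 ^ p ^ Suc k - L (Suc j) ^ p ^ (k - j)"
  using \<open>j \<le> k\<close>
proof (induction j)
  case 0
  then show ?case using frobenius_lift_power_dvd[of p L k 0, OF L] by simp
next
  case (Suc j)
  define m where "m = k - Suc j"
  have m: "k - j = Suc m" using Suc.prems by (simp add: m_def)
  have "of_nat p ^ Suc (Suc m) dvd L 0 ^ p ^ Suc k - L (Suc j) ^ p ^ Suc m"
    using Suc by (simp add: m)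
  then have "of_nat p ^ Suc m dvd L 0 ^ p ^ Suc k - L (Suc j) ^ p ^ Suc m"
    by (rule power_le_dvd) simp
  moreover have "of_nat p ^ Suc m dvd L (Suc j) ^ p ^ Suc m - L (Suc (Suc j)) ^ p ^ m"
    by (rule frobenius_lift_power_dvd) (rule L)
  ultimately have "of_nat p ^ Suc m dvd (L 0 ^ p ^ Suc k - L (Suc j) ^ p ^ Suc m)
      + (L (Suc j) ^ p ^ Suc m - L (Suc (Suc j)) ^ p ^ m)"
    by (rule dvd_add)
  then show ?case unfolding m_def[symmetric] by simp
qed

text \<open>
  Since \<open>n (s + 1) = n s + h * p ^ s\<close>, multiplying the expansion of \<open>L 0 ^ n s\<close> by
  \<open>L 0 ^ (h * p ^ s)\<close> and comparing it with the defining expansion of \<open>L 0 ^ n (s + 1)\<close> writes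
  \<open>ghost L n s\<close> as a sum over \<open>j < s\<close> of \<open>ghost L n j\<close> times
  \<open>L 0 ^ (h * p ^ s) - L (j + 1) ^ (h * p ^ (s - j - 1))\<close>. The induction hypothesis gives
  \<open>p ^ j\<close> for the first factor, and the comparison of powers gives \<open>p ^ (s - j)\<close> for the second.
\<close>

lemma ghost_dvd:
  fixes L :: "nat \<Rightarrow> 'a::comm_ring_1"
  assumes L: "\<And>j. of_nat p dvd L j ^ p - L (Suc j)"
    and n: "\<And>s. n (Suc s) = n s + h * p ^ s"
    and n0: "n 0 = 0"
  shows "of_nat p ^ s dvd ghost L n s"
proof (induction s rule: less_induct)
  case (less s)
  show ?case
  proof (cases s)
    case 0
    then show ?thesis by simp
  next
    case (Suc r)
    have G: "L 0 ^ n (Suc r) = (\<Sum>j\<le>r. ghost L n j * L (Suc j) ^ n (r - j))"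
      using ghost.simps[of L n r] n0
      by (simp add: lessThan_Suc_atMost[symmetric] del: power_Suc)
    have "ghost L n s = L 0 ^ n (Suc r) * L 0 ^ (h * p ^ s)
        - (\<Sum>j\<le>r. ghost L n j * L (Suc j) ^ n (s - j))"
      using ghost.simps[of L n s] n[of s]
      by (simp add: Suc power_add lessThan_Suc_atMost)
    also have "\<dots> = (\<Sum>j\<le>r. ghost L n j * L (Suc j) ^ n (r - j)
        * (L 0 ^ (h * p ^ s) - L (Suc j) ^ (h * p ^ (r - j))))"
      unfolding G sum_distrib_right sum_subtractf[symmetric]
      by (intro sum.cong refl) (simp add: Suc Suc_diff_le n power_add algebra_simps)
    also have "of_nat p ^ s dvd \<dots>"
    proof (intro dvd_sum)
      fix j assume j: "j \<in> {..r}"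
      have "of_nat p ^ Suc (r - j) dvd L 0 ^ p ^ s - L (Suc j) ^ p ^ (r - j)"
        using frobenius_lift_power_dvd_iterated[of p L j r, OF L] j Suc by simp
      then have "of_nat p ^ Suc (r - j) dvd L 0 ^ (h * p ^ s) - L (Suc j) ^ (h * p ^ (r - j))"
        unfolding mult.commute[of h] power_mult by (rule dvd_power_diff)
      moreover have "of_nat p ^ j dvd ghost L n j * L (Suc j) ^ n (r - j)"
        using less[of j] j Suc by auto
      ultimately have "of_nat p ^ j * of_nat p ^ Suc (r - j) dvd ghost L n j * L (Suc j) ^ n (r - j)
        * (L 0 ^ (h * p ^ s) - L (Suc j) ^ (h * p ^ (r - j)))"
        by (intro mult_dvd_mono)
      moreover have "j + Suc (r - j) = s" using j Suc by simp
      ultimately show "of_nat p ^ s dvd ghost L n j * L (Suc j) ^ n (r - j)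
        * (L 0 ^ (h * p ^ s) - L (Suc j) ^ (h * p ^ (r - j)))"
        by (simp only: power_add[symmetric])
    qed
    finally show ?thesis .
  qed
qed

text \<open>
  Inserting the two expansions makes the left-hand side a sum of terms \<open>a j i\<close> times
  cross differences \<open>P (s + 1 - j) (i + 1 + j) * P s (i + 1) - P (s - j) (i + 1 + j) * P (s + 1) (i + 1)\<close>.
  As \<open>c ^ j\<close> divides \<open>a j i\<close>, the cross difference has to be divisible by \<open>c ^ (s + 1 - j)\<close>. In terms
  of ratios this says that \<open>P (s + 1) k / P s k\<close> agrees with \<open>P (s + 1 - j) (k + j) / P (s - j) (k + j)\<close>,
  which is a chain of \<open>j\<close> smaller instances of the congruence. Since the \<open>P s i\<close> are units, such ratios make sense
  in a ring without division.
\<close>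

lemma dwork_congruence_of_ghost_expansion:
  fixes P :: "nat \<Rightarrow> nat \<Rightarrow> 'a::comm_ring_1"
  assumes P0: "\<And>i. P 0 i = 1"
    and unit: "\<And>s i. \<exists>u. u * P s i = 1"
    and exp: "\<And>s i. P (Suc s) i = (\<Sum>j\<le>s. a j i * P (s - j) (i + Suc j))"
    and a: "\<And>j i. c ^ j dvd a j i"
  shows "c ^ Suc s dvd P (Suc (Suc s)) i * P s (Suc i) - P (Suc s) i * P (Suc s) (Suc i)"
proof (induction s arbitrary: i rule: less_induct)
  case (less s)
  have *: "c ^ (Suc s - j) dvd P (Suc s) k * P (s - j) (k + j) - P s k * P (Suc s - j) (k + j)"
    if "j \<le> s" for j k
    using that
  proof (induction j)
    case 0
    then show ?case by simp
  next
    case (Suc j)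
    define m where "m = s - Suc j"
    have m: "Suc s - j = Suc (Suc m)" "s - j = Suc m" "Suc s - Suc j = Suc m" "m < s"
      using Suc.prems by (auto simp: m_def)
    have B: "c ^ Suc m dvd P (Suc s) k * P (Suc m) (k + j) - P s k * P (Suc (Suc m)) (k + j)"
      using Suc.IH[OF Suc_leD[OF Suc.prems]] unfolding m
      by (rule power_le_dvd) simp
    have C: "c ^ Suc m dvd P (Suc (Suc m)) (k + j) * P m (Suc (k + j))
        - P (Suc m) (k + j) * P (Suc m) (Suc (k + j))"
      by (rule less.IH[OF m(4)])
    define X where "X = P (Suc s) k * P m (Suc (k + j)) - P s k * P (Suc m) (Suc (k + j))"
    have "P (Suc m) (k + j) * X =
       (P (Suc s) k * P (Suc m) (k + j) - P s k * P (Suc (Suc m)) (k + j)) * P m (Suc (k + j))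
       + P s k * (P (Suc (Suc m)) (k + j) * P m (Suc (k + j))
        - P (Suc m) (k + j) * P (Suc m) (Suc (k + j)))"
      by (simp add: X_def algebra_simps)
    also have "c ^ Suc m dvd \<dots>" using B C by (intro dvd_add dvd_mult dvd_mult2)
    finally have "c ^ Suc m dvd P (Suc m) (k + j) * X" .
    moreover obtain u where "u * P (Suc m) (k + j) = 1" using unit by blast
    ultimately have "c ^ Suc m dvd X"
      by (metis dvd_mult mult.assoc mult_1)
    then show ?case by (simp only: m X_def m_def[symmetric] add_Suc_right)
  qed
  have "P (Suc (Suc s)) i * P s (Suc i) - P (Suc s) i * P (Suc s) (Suc i)
    = (\<Sum>j\<le>s. a j i * (P (Suc s - j) (Suc i + j) * P s (Suc i) - P (s - j) (Suc i + j) * P (Suc s) (Suc i)))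
      + a (Suc s) i * P 0 (i + Suc (Suc s)) * P s (Suc i)"
    unfolding exp[of s i] exp[of "Suc s" i]
    by (simp add: sum_distrib_left sum_distrib_right sum_subtractf algebra_simps)
  also have "c ^ Suc s dvd \<dots>"
  proof (intro dvd_add dvd_sum)
    show "c ^ Suc s dvd a (Suc s) i * P 0 (i + Suc (Suc s)) * P s (Suc i)"
      by (intro dvd_mult2 a)
    fix j assume j: "j \<in> {..s}"
    have "c ^ (Suc s - j) dvd P (Suc s - j) (Suc i + j) * P s (Suc i) - P (s - j) (Suc i + j) * P (Suc s) (Suc i)"
    proof -
      have "c ^ (Suc s - j) dvd - (P (Suc s) (Suc i) * P (s - j) (Suc i + j) - P s (Suc i) * P (Suc s - j) (Suc i + j))"
        unfolding dvd_minus_iff by (rule *) (use j in simp)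
      then show ?thesis by (simp only: minus_diff_eq) (simp only: mult.commute)
    qed
    then have "c ^ j * c ^ (Suc s - j) dvd a j i * (P (Suc s - j) (Suc i + j) * P s (Suc i) - P (s - j) (Suc i + j) * P (Suc s) (Suc i))"
      by (intro mult_dvd_mono a)
    moreover have "j + (Suc s - j) = Suc s" using j by simp
    ultimately show "c ^ Suc s dvd a j i * (P (Suc s - j) (Suc i + j) * P s (Suc i) - P (s - j) (Suc i + j) * P (Suc s) (Suc i))"
      by (simp only: power_add[symmetric])
  qed
  finally show ?case .
qed

section \<open>The truncations as coefficients of powers\<close>

abbreviation half_exp :: "nat \<Rightarrow> nat \<Rightarrow> nat" where
  "half_exp p s \<equiv> (p ^ s - 1) div 2"

text \<open>
  With \<open>t\<close> the outer variable, this is \<open>(1 + t ^ q) * (t ^ q + x ^ q)\<close> for \<open>q = p ^ j\<close>, the image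
  of \<open>(1 + t) * (t + x)\<close> under \<open>t \<mapsto> t ^ q\<close>, \<open>x \<mapsto> x ^ q\<close>. The coefficient of \<open>t ^ n\<close> in
  \<open>((1 + t) * (t + x)) ^ n\<close> is \<open>\<Sum>k\<le>n. (n choose k)\<^sup>2 * x ^ k\<close>.
\<close>

definition bifactor :: "nat \<Rightarrow> 'a::comm_ring_1 \<Rightarrow> nat \<Rightarrow> 'a poly" where
  "bifactor p x j = (1 + Polynomial.monom 1 (p ^ j)) * (Polynomial.monom 1 (p ^ j) + [:x ^ p ^ j:])"

lemma poly_Pbar:
  "poly (Pbar p s) x = (\<Sum>k\<le>half_exp p s. of_nat ((half_exp p s choose k)\<^sup>2) * x ^ k)"
  by (simp add: Pbar_def poly_sum poly_monom)

text \<open>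
  The second factor is a polynomial in \<open>t ^ q\<close>, and \<open>V\<close> is too short to reach from one
  multiple of \<open>q\<close> to the next. Hence only the middle coefficient of the power,
  the one of \<open>t ^ (q * n)\<close>, contributes.
\<close>

lemma coeff_mult_bifactor_power:
  fixes V :: "'a::comm_ring_1 poly"
  assumes deg: "degree V < q" and e: "e < q"
  shows "Polynomial.coeff (V * ((1 + Polynomial.monom 1 q) * (Polynomial.monom 1 q + [:y:])) ^ n) (e + q * n)
    = Polynomial.coeff V e * (\<Sum>k\<le>n. of_nat ((n choose k)\<^sup>2) * y ^ k)"
proof -
  let ?m = "Polynomial.monom :: 'a \<Rightarrow> nat \<Rightarrow> 'a poly"
  have A: "(1 + ?m 1 q) ^ n = (\<Sum>i\<le>n. ?m (of_nat (n choose i)) (q * i))"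
    unfolding add.commute[of 1] binomial_ring
    by (intro sum.cong) (simp_all add: monom_power of_nat_monom mult_monom mult.commute)
  have C: "[:y:] = ?m y 0" by (simp add: monom_0)
  have B: "(?m 1 q + [:y:]) ^ n = (\<Sum>k\<le>n. ?m (of_nat (n choose k) * y ^ k) (q * (n - k)))"
    unfolding add.commute[of "?m 1 q"] binomial_ring C
    by (intro sum.cong) (simp_all add: monom_power of_nat_monom mult_monom mult.commute)
  have expand: "Polynomial.coeff (V * (?m (of_nat (n choose i)) (q * i) * ?m (of_nat (n choose k) * y ^ k) (q * (n - k)))) (e + q * n)
     = (if k = i then Polynomial.coeff V e * (of_nat ((n choose k)\<^sup>2) * y ^ k) else 0)"
    if "i \<le> n" "k \<le> n" for i k
  proof -
    have *: "Polynomial.coeff (V * (?m (of_nat (n choose i)) (q * i) * ?m (of_nat (n choose k) * y ^ k) (q * (n - k)))) (e + q * n)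
      = (if e + q * n < q * i + q * (n - k) then 0
         else of_nat (n choose i) * (of_nat (n choose k) * y ^ k) * Polynomial.coeff V (e + q * n - (q * i + q * (n - k))))"
      by (simp add: mult_monom mult.commute[of V] coeff_monom_mult)
    \<comment> \<open>the exponent of \<open>t\<close> that \<open>V\<close> has to supply is \<open>e + q * (k - i)\<close>\<close>
    consider "i = k" | "i < k" | "k < i" by linarith
    then show ?thesis
    proof cases
      case 1
      have "q * k + q * (n - k) = q * n" using that by (simp flip: distrib_left)
      then show ?thesis unfolding * using 1 by (simp add: power2_eq_square mult_ac)
    next
      case 2
      have "q * i + q * (n - k) + q * (k - i) = q * n" using that 2 by (simp flip: distrib_left)
      moreover have "q \<le> q * (k - i)" using mult_le_mono2[of 1 "k - i" q] 2 by linarith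
      ultimately have "degree V < e + q * n - (q * i + q * (n - k))" using deg by linarith
      then show ?thesis unfolding * using 2 by (simp add: coeff_eq_0)
    next
      case 3
      have "q * i + q * (n - k) = q * n + q * (i - k)" using that 3 by (simp add: diff_mult_distrib2)
      moreover have "q \<le> q * (i - k)" using mult_le_mono2[of 1 "i - k" q] 3 by linarith
      ultimately have "e + q * n < q * i + q * (n - k)" using e by linarith
      then show ?thesis unfolding * using 3 by simp
    qed
  qed
  have "Polynomial.coeff (V * ((1 + ?m 1 q) * (?m 1 q + [:y:])) ^ n) (e + q * n)
    = (\<Sum>i\<le>n. \<Sum>k\<le>n. if k = i then Polynomial.coeff V e * (of_nat ((n choose k)\<^sup>2) * y ^ k) else 0)"
    unfolding power_mult_distrib A B sum_product
    unfolding sum_distrib_left coeff_sum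
    by (intro sum.cong refl expand) auto
  also have "\<dots> = Polynomial.coeff V e * (\<Sum>k\<le>n. of_nat ((n choose k)\<^sup>2) * y ^ k)"
    by (simp add: sum_distrib_left)
  finally show ?thesis .
qed

lemma degree_bifactor_power: "degree (bifactor p x j ^ n) \<le> 2 * p ^ j * n"
proof -
  have "degree (bifactor p x j) \<le> p ^ j + p ^ j"
    unfolding bifactor_def
    by (intro order.trans[OF degree_mult_le] add_mono degree_add_le)
       (auto simp: degree_monom_le)
  then show ?thesis
    by (intro order.trans[OF degree_power_le]) (auto intro!: mult_right_mono)
qed

lemma bifactor_frobenius:
  assumes p: "prime p"
  shows "of_nat p dvd bifactor p x j ^ p - bifactor p x (Suc j)"
proof -
  let ?q = "p ^ j" and ?m = "Polynomial.monom :: 'a \<Rightarrow> nat \<Rightarrow> 'a poly"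
  have A: "of_nat p dvd (1 + ?m 1 ?q) ^ p - (1 + ?m 1 (p * ?q))"
    using prime_dvd_add_power_diff[OF p, of 1 "?m 1 ?q"] by (simp add: monom_power mult.commute)
  have B: "of_nat p dvd (?m 1 ?q + [:x ^ ?q:]) ^ p - (?m 1 (p * ?q) + [:x ^ (p * ?q):])"
    using prime_dvd_add_power_diff[OF p, of "?m 1 ?q" "[:x ^ ?q:]"]
    by (simp add: monom_power poly_const_pow mult.commute flip: power_mult)
  have split: "(a * b) ^ p - c * d = (a ^ p - c) * b ^ p + c * (b ^ p - d)" for a b c d :: "'a poly"
    by (simp add: power_mult_distrib algebra_simps)
  show ?thesis
    unfolding bifactor_def split power_Suc by (intro dvd_add dvd_mult dvd_mult2 A B)
qed

text \<open>
  All base-\<open>p\<close> digits of \<open>(p ^ s - 1) / 2\<close> are equal to \<open>(p - 1) / 2\<close>, so that removing the lowest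
  \<open>k\<close> digits leaves a number of the same kind.
\<close>

lemma half_exp:
  assumes "odd p"
  shows "2 * half_exp p s = p ^ s - 1" "half_exp p (Suc s) = half_exp p s + half_exp p 1 * p ^ s"
    "k \<le> s \<Longrightarrow> half_exp p s = half_exp p k + p ^ k * half_exp p (s - k)"
proof -
  have e: "2 * half_exp p s = p ^ s - 1" for s using assms by simp
  then show "2 * half_exp p s = p ^ s - 1" .
  have p1: "p ^ s \<ge> 1" for s using assms by (cases p) auto
  have *: "half_exp p s = half_exp p k + p ^ k * half_exp p (s - k)" if "k \<le> s" for k s
  proof -
    have "int (p ^ s) = int (p ^ k) * int (p ^ (s - k))"
      using that by (simp flip: power_add)
    moreover have "int (2 * half_exp p i) = int (p ^ i) - 1" for i
      unfolding e using p1[of i] by (simp add: of_nat_diff)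
    ultimately have "int (2 * half_exp p s) = int (2 * half_exp p k) + int (p ^ k) * int (2 * half_exp p (s - k))"
      by (simp only: right_diff_distrib mult_1_right)
    then have "int (2 * half_exp p s) = int (2 * half_exp p k + p ^ k * (2 * half_exp p (s - k)))"
      by (simp only: of_nat_add of_nat_mult)
    then show ?thesis by (simp only: of_nat_eq_iff)
  qed
  then show "k \<le> s \<Longrightarrow> half_exp p s = half_exp p k + p ^ k * half_exp p (s - k)" .
  show "half_exp p (Suc s) = half_exp p s + half_exp p 1 * p ^ s"
    using *[of s "Suc s"] by (simp add: mult.commute)
qed

text \<open>
  The bound makes it possible to compare coefficients summand by summand: \<open>2 * half_exp p (s + 1) = p ^ (s + 1) - 1\<close>
  bounds the degree of the leading power, and the degrees of the products in the recursion add up to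
  \<open>p ^ (s + 1) - 1\<close> as well.
\<close>

lemma degree_ghost:
  assumes "odd p"
  shows "degree (ghost (bifactor p x) (half_exp p) s) < p ^ Suc s"
proof (induction s rule: less_induct)
  case (less s)
  have p0: "p > 0" using assms by (cases p) auto
  have p1: "p ^ i \<ge> 1" for i using p0 by simp
  have "degree (ghost (bifactor p x) (half_exp p) s) \<le> p ^ Suc s - 1"
    unfolding ghost.simps[of _ _ s]
  proof (intro degree_diff_le degree_sum_le)
    show "degree (bifactor p x 0 ^ half_exp p (Suc s)) \<le> p ^ Suc s - 1"
      using degree_bifactor_power[of p x 0 "half_exp p (Suc s)"] half_exp(1)[OF assms, of "Suc s"]
      by simp
    fix j assume "j \<in> {..<s}"
    then have j: "j < s" by simp
    have "degree (bifactor p x (Suc j) ^ half_exp p (s - j)) \<le> p ^ Suc j * (2 * half_exp p (s - j))"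
      using degree_bifactor_power[of p x "Suc j" "half_exp p (s - j)"] by (simp add: mult_ac)
    also have "\<dots> = p ^ Suc s - p ^ Suc j"
      using j by (simp only: half_exp(1)[OF assms] diff_mult_distrib2 power_add[symmetric]) simp
    finally have "degree (bifactor p x (Suc j) ^ half_exp p (s - j)) \<le> p ^ Suc s - p ^ Suc j" .
    moreover have "degree (ghost (bifactor p x) (half_exp p) j) < p ^ Suc j" by (rule less.IH[OF j])
    moreover have "p ^ Suc j \<le> p ^ Suc s" using j p0 by (intro power_increasing) auto
    ultimately show "degree (ghost (bifactor p x) (half_exp p) j * bifactor p x (Suc j) ^ half_exp p (s - j)) \<le> p ^ Suc s - 1"
      by (intro order.trans[OF degree_mult_le]) linarith
  qed simp
  then show ?case using p1[of "Suc s"] by linarith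
qed

lemma of_nat_dvd_coeff:
  fixes V :: "'a::comm_ring_1 poly"
  assumes "of_nat p ^ m dvd V"
  shows "of_nat p ^ m dvd Polynomial.coeff V e"
proof -
  obtain W where "V = of_nat p ^ m * W" using assms by (auto simp: dvd_def)
  then have "V = of_nat (p ^ m) * W" by simp
  then have "Polynomial.coeff V e = of_nat (p ^ m) * Polynomial.coeff W e" by (simp only: of_nat_poly) simp
  then show ?thesis by simp
qed

text \<open>
  This is the coefficient of \<open>t ^ half_exp p (s + 1)\<close> in the ghost expansion of
  \<open>bifactor p x 0 ^ half_exp p (s + 1)\<close>: by the degree bound it splits in every summand into a
  coefficient of the ghost term and the middle coefficient of the power.
\<close>

lemma Pbar_ghost_expansion:
  fixes x :: "'a::comm_ring_1"
  assumes p: "prime p" and odd: "odd p"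
  obtains a where "\<And>j. of_nat p ^ j dvd a j"
    "\<And>s. poly (Pbar p (Suc s)) x = (\<Sum>j\<le>s. a j * poly (Pbar p (s - j)) (x ^ p ^ Suc j))"
proof
  let ?G = "ghost (bifactor p x) (half_exp p)"
  have p1: "p > 1" using p prime_gt_1_nat by blast
  have "of_nat p ^ j dvd ?G j" for j
    by (rule ghost_dvd[where h = "half_exp p 1" and n = "half_exp p", OF _ half_exp(2)[OF odd]])
       (rule bifactor_frobenius[OF p], simp)
  then show "of_nat p ^ j dvd Polynomial.coeff (?G j) (half_exp p (Suc j))" for j
    by (rule of_nat_dvd_coeff)
  fix s
  have "poly (Pbar p (Suc s)) x = Polynomial.coeff (bifactor p x 0 ^ half_exp p (Suc s)) (half_exp p (Suc s))"
    using coeff_mult_bifactor_power[of 1 1 0 x "half_exp p (Suc s)"]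
    by (simp add: poly_Pbar bifactor_def)
  also have "bifactor p x 0 ^ half_exp p (Suc s) = (\<Sum>j\<le>s. ?G j * bifactor p x (Suc j) ^ half_exp p (s - j))"
    using ghost.simps[of "bifactor p x" "half_exp p" s] by (simp add: lessThan_Suc_atMost[symmetric] del: power_Suc)
  also have "Polynomial.coeff \<dots> (half_exp p (Suc s)) = (\<Sum>j\<le>s. Polynomial.coeff (?G j) (half_exp p (Suc j)) * poly (Pbar p (s - j)) (x ^ p ^ Suc j))"
    unfolding coeff_sum
  proof (intro sum.cong refl)
    fix j assume "j \<in> {..s}"
    then have "Suc j \<le> Suc s" by simp
    then have e: "half_exp p (Suc s) = half_exp p (Suc j) + p ^ Suc j * half_exp p (s - j)"
      using half_exp(3)[OF odd, of "Suc j" "Suc s"] by simp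
    have "half_exp p (Suc j) < p ^ Suc j"
      using half_exp(1)[OF odd, of "Suc j"] p1 by (simp add: div_less_iff_less_mult less_imp_diff_less)
    then show "Polynomial.coeff (?G j * bifactor p x (Suc j) ^ half_exp p (s - j)) (half_exp p (Suc s))
      = Polynomial.coeff (?G j) (half_exp p (Suc j)) * poly (Pbar p (s - j)) (x ^ p ^ Suc j)"
      unfolding e poly_Pbar bifactor_def[of p x "Suc j"]
      by (intro coeff_mult_bifactor_power degree_ghost[OF odd])
  qed
  finally show "poly (Pbar p (Suc s)) x
    = (\<Sum>j\<le>s. Polynomial.coeff (?G j) (half_exp p (Suc j)) * poly (Pbar p (s - j)) (x ^ p ^ Suc j))" .
qed

lemma Pbar_0 [simp]: "Pbar p 0 = 1"
  by (simp add: Pbar_def flip: one_poly_eq_simps)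

lemma (in comm_ring_hom) hom_poly_Pbar: "hom (poly (Pbar p s) x) = poly (Pbar p s) (hom x)"
  by (simp add: poly_Pbar hom_distribs)

section \<open>The Dwork congruence for the truncations\<close>

lemma poly_Pbar_0: "poly (Pbar p s) 0 = (1 :: 'a::comm_ring_1)"
proof -
  have "poly (Pbar p s) 0 = (\<Sum>k\<le>half_exp p s. if k = 0 then 1 else 0 :: 'a)"
    unfolding poly_Pbar by (intro sum.cong) (auto simp: zero_power)
  then show ?thesis by simp
qed

lemma of_int_poly_Pbar: "of_int_poly (Pbar p s) = (Pbar p s :: 'a::comm_ring_1 poly)"
  unfolding Pbar_def by (simp add: hom_distribs map_poly_monom)

text \<open>
  The congruence is proved in the ring of integral power series, where the truncations are
  units because their constant coefficient is \<open>1\<close>, and divisibility by a power of \<open>p\<close> is then read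
  off coefficientwise.
\<close>

lemma Pbar_dwork_congruence:
  fixes X :: "int poly"
  assumes p: "prime p" and odd: "odd p"
  defines "X \<equiv> [:0, 1:]"
  shows "of_nat p ^ Suc s dvd poly (Pbar p (Suc (Suc s))) X * poly (Pbar p s) (X ^ p)
     - poly (Pbar p (Suc s)) X * poly (Pbar p (Suc s)) (X ^ p)" (is "_ dvd ?D")
proof -
  interpret h: comm_ring_hom "fps_of_poly :: int poly \<Rightarrow> int fps"
    by unfold_locales (auto simp: fps_of_poly_add fps_of_poly_mult)
  have hX: "fps_of_poly X = fps_X" by (simp add: X_def fps_of_poly_pCons)
  define Q :: "nat \<Rightarrow> nat \<Rightarrow> int fps" where "Q s i = poly (Pbar p s) (fps_X ^ p ^ i)" for s i
  obtain a :: "nat \<Rightarrow> nat \<Rightarrow> int fps" where a: "\<And>i j. of_nat p ^ j dvd a j i"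
    "\<And>i s. poly (Pbar p (Suc s)) (fps_X ^ p ^ i)
      = (\<Sum>j\<le>s. a j i * poly (Pbar p (s - j)) ((fps_X ^ p ^ i) ^ p ^ Suc j))"
  proof -
    have "\<exists>a. (\<forall>j. of_nat p ^ j dvd a j) \<and> (\<forall>s. poly (Pbar p (Suc s)) (fps_X ^ p ^ i :: int fps)
      = (\<Sum>j\<le>s. a j * poly (Pbar p (s - j)) ((fps_X ^ p ^ i) ^ p ^ Suc j)))" for i
      by (rule Pbar_ghost_expansion[OF p odd, of "fps_X ^ p ^ i :: int fps"]) blast
    then have "\<forall>i. \<exists>a. (\<forall>j. of_nat p ^ j dvd a j) \<and> (\<forall>s. poly (Pbar p (Suc s)) (fps_X ^ p ^ i :: int fps)
      = (\<Sum>j\<le>s. a j * poly (Pbar p (s - j)) ((fps_X ^ p ^ i) ^ p ^ Suc j)))" by blast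
    from choice[OF this] obtain b where "\<forall>i. (\<forall>j. of_nat p ^ j dvd b i j) \<and> (\<forall>s. poly (Pbar p (Suc s)) (fps_X ^ p ^ i :: int fps)
      = (\<Sum>j\<le>s. b i j * poly (Pbar p (s - j)) ((fps_X ^ p ^ i) ^ p ^ Suc j)))" ..
    then show ?thesis by (intro that[of "\<lambda>j i. b i j"]) blast+
  qed
  have "of_nat p ^ Suc s dvd Q (Suc (Suc s)) 0 * Q s (Suc 0) - Q (Suc s) 0 * Q (Suc s) (Suc 0)"
  proof (rule dwork_congruence_of_ghost_expansion[where a = a])
    show "Q 0 i = 1" for i by (simp add: Q_def)
    show "of_nat p ^ j dvd a j i" for i j by (rule a)
    show "Q (Suc s) i = (\<Sum>j\<le>s. a j i * Q (s - j) (i + Suc j))" for s i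
      unfolding Q_def a(2) by (simp add: power_mult[symmetric] power_add mult_ac)
    show "\<exists>u. u * Q s i = 1" for s i
    proof -
      have "p ^ i > 0" using p prime_gt_0_nat by simp
      then have "fps_nth (Q s i) 0 = (\<Sum>k\<le>half_exp p s. if k = 0 then 1 else 0)"
        unfolding Q_def poly_Pbar fps_sum_nth
        by (intro sum.cong refl) (auto simp: fps_mult_nth_0 fps_nth_power_0 power_0_left)
      then have "fps_nth (Q s i) 0 = 1" by simp
      then have "fps_left_inverse (Q s i) 1 * Q s i = 1"
        by (intro fps_left_inverse) simp
      then show ?thesis by blast
    qed
  qed
  then have "of_nat p ^ Suc s dvd fps_of_poly ?D"
    by (simp add: Q_def hX h.hom_poly_Pbar fps_of_poly_diff fps_of_poly_mult fps_of_poly_power)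
  then obtain W where W: "fps_of_poly ?D = of_nat (p ^ Suc s) * W" by (auto simp: dvd_def)
  have "[:of_nat (p ^ Suc s):] dvd ?D"
    unfolding const_poly_dvd_iff
  proof
    fix n
    have "Polynomial.coeff ?D n = fps_nth (fps_of_poly ?D) n" by simp
    then show "of_nat (p ^ Suc s) dvd Polynomial.coeff ?D n" unfolding W by (simp add: fps_of_nat[symmetric] del: of_nat_power)
  qed
  moreover have "(of_nat p ^ Suc s :: int poly) = [:of_nat (p ^ Suc s):]"
    by (rule trans[OF of_nat_power[symmetric] of_nat_poly])
  ultimately show ?thesis by (simp only:)
qed

text \<open>
  Divisibility by \<open>p\<close> carries no information in a field such as the \<open>p\<close>-adic numbers. What survives
  evaluation is the quotient \<open>R\<close>, a polynomial with integer coefficients not depending on the point.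
\<close>

lemma Pbar_dwork_congruence_eval:
  assumes p: "prime p" and odd: "odd p"
  obtains R :: "int poly" where
    "\<And>x :: 'a::comm_ring_1. poly (Pbar p (Suc (Suc s))) x * poly (Pbar p s) (x ^ p)
     - poly (Pbar p (Suc s)) x * poly (Pbar p (Suc s)) (x ^ p)
     = of_nat p ^ Suc s * poly (of_int_poly R) x"
proof -
  obtain R where R: "poly (Pbar p (Suc (Suc s))) [:0, 1:] * poly (Pbar p s) ([:0, 1:] ^ p)
     - poly (Pbar p (Suc s)) [:0, 1:] * poly (Pbar p (Suc s)) ([:0, 1:] ^ p)
     = of_nat p ^ Suc s * (R :: int poly)"
    using Pbar_dwork_congruence[OF assms] by (auto simp: dvd_def)
  show ?thesis
  proof (rule that)
    fix x :: 'a
    define ev :: "int poly \<Rightarrow> 'a" where "ev Q = poly (of_int_poly Q) x" for Q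
    interpret ev: comm_ring_hom ev
      by unfold_locales (auto simp: ev_def hom_distribs)
    have X: "ev [:0, 1:] = x" by (simp add: ev_def)
    have e: "ev (poly (Pbar p s) Y) = poly (Pbar p s) (ev Y)" for s Y
      by (rule ev.hom_poly_Pbar)
    have "poly (Pbar p (Suc (Suc s))) x * poly (Pbar p s) (x ^ p)
        - poly (Pbar p (Suc s)) x * poly (Pbar p (Suc s)) (x ^ p)
      = ev (poly (Pbar p (Suc (Suc s))) [:0, 1:] * poly (Pbar p s) ([:0, 1:] ^ p)
        - poly (Pbar p (Suc s)) [:0, 1:] * poly (Pbar p (Suc s)) ([:0, 1:] ^ p))"
      by (simp only: ev.hom_minus ev.hom_mult ev.hom_power e X)
    also have "\<dots> = ev (of_nat p ^ Suc s * R)" by (simp only: R)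
    also have "\<dots> = of_nat p ^ Suc s * poly (of_int_poly R) x"
      by (simp only: ev.hom_mult ev.hom_power ev.hom_of_nat) (simp only: ev_def)
    finally show "poly (Pbar p (Suc (Suc s))) x * poly (Pbar p s) (x ^ p)
     - poly (Pbar p (Suc s)) x * poly (Pbar p (Suc s)) (x ^ p)
     = of_nat p ^ Suc s * poly (of_int_poly R) x" .
  qed
qed

section \<open>The \<open>p\<close>-adic numbers as a complete topological field\<close>

lemma padic_norm_0 [simp]: "padic_norm (0 :: 'p::prime_card padic) = 0"
  by simp

lemma padic_norm_diff_commute: "padic_norm (x - y) = padic_norm (y - x :: 'p::prime_card padic)"
  using padic_norm_minus[of "x - y"] by simp

lemma padic_norm_diff_le_max:
  "padic_norm (x - y) \<le> max (padic_norm x) (padic_norm (y :: 'p::prime_card padic))"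
  using padic_norm_ultrametric[of x "- y"] by simp

lemma padic_norm_add_less:
  "padic_norm x < e \<Longrightarrow> padic_norm y < e \<Longrightarrow> padic_norm (x + y :: 'p::prime_card padic) < e"
  by (rule order.strict_trans1[OF padic_norm_ultrametric]) simp

lemma padic_norm_diff_less:
  "padic_norm x < e \<Longrightarrow> padic_norm y < e \<Longrightarrow> padic_norm (x - y :: 'p::prime_card padic) < e"
  by (rule order.strict_trans1[OF padic_norm_diff_le_max]) simp

lemma padic_norm_triangle: "padic_norm (x + y) \<le> padic_norm x + padic_norm (y :: 'p::prime_card padic)"
  using padic_norm_ultrametric[of x y] padic_norm_nonneg[of x] padic_norm_nonneg[of y] by linarith

instance padic :: (prime_card) topological_ab_group_add
proof
  fix a b :: "'a padic"
  show "((\<lambda>x. fst x + snd x) \<longlongrightarrow> a + b) (nhds a \<times>\<^sub>F nhds b)"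
    unfolding tendsto_iff
  proof (intro allI impI)
    fix e :: real assume e: "e > 0"
    have "eventually (\<lambda>x. dist (fst x + snd x) (a + b) < e) (nhds a \<times>\<^sub>F nhds b)"
      unfolding eventually_prod_filter
    proof (intro exI conjI allI impI)
      show "eventually (\<lambda>x. dist x a < e) (nhds a)" "eventually (\<lambda>x. dist x b < e) (nhds b)"
        using e by (auto simp: eventually_nhds_metric)
      fix x y assume "dist x a < e" "dist y b < e"
      then show "dist (fst (x, y) + snd (x, y)) (a + b) < e"
        using padic_norm_ultrametric[of "x - a" "y - b"]
        by (simp add: dist_padic_def add_diff_add)
    qed
    then show "eventually (\<lambda>x. dist (fst x + snd x) (a + b) < e) (nhds a \<times>\<^sub>F nhds b)" .
  qed
  show "(uminus \<longlongrightarrow> - a) (nhds a)"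
    unfolding tendsto_iff
  proof (intro allI impI)
    fix e :: real assume e: "e > 0"
    have "dist (- x) (- a) = dist x a" for x
      using padic_norm_minus[of "x - a"] by (simp add: dist_padic_def)
    then show "eventually (\<lambda>x. dist (- x) (- a) < e) (nhds a)"
      using e by (auto simp: eventually_nhds_metric)
  qed
qed

instance padic :: (prime_card) topological_comm_monoid_mult
proof
  fix a b :: "'a padic"
  show "((\<lambda>x. fst x * snd x) \<longlongrightarrow> a * b) (nhds a \<times>\<^sub>F nhds b)"
    unfolding tendsto_iff
  proof (intro allI impI)
    fix e :: real assume e: "e > 0"
    define M where "M = padic_norm a + padic_norm b + 1"
    have M: "M > 0" "padic_norm a \<le> M" "padic_norm b + 1 \<le> M"
      using padic_norm_nonneg[of a] padic_norm_nonneg[of b] unfolding M_def by linarith+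
    \<comment> \<open>the bound \<open>1\<close> on \<open>d\<close> keeps \<open>y\<close> within norm \<open>M\<close>\<close>
    define d where "d = min 1 (e / M)"
    have d: "d > 0" "d \<le> 1" using e M by (auto simp: d_def)
    have dM: "d * M \<le> e" using M by (simp add: d_def min_def field_simps)
    show "eventually (\<lambda>x. dist (fst x * snd x) (a * b) < e) (nhds a \<times>\<^sub>F nhds b)"
      unfolding eventually_prod_filter
    proof (intro exI conjI allI impI)
      show "eventually (\<lambda>x. dist x a < d) (nhds a)" "eventually (\<lambda>x. dist x b < d) (nhds b)"
        using d by (auto simp: eventually_nhds_metric)
      fix x y assume x: "dist x a < d" and y: "dist y b < d"
      have "padic_norm y \<le> M"
        using padic_norm_triangle[of "y - b" b] y d M by (simp add: dist_padic_def)
      then have "padic_norm ((x - a) * y) \<le> padic_norm (x - a) * M"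
        unfolding padic_norm_mult by (intro mult_left_mono) auto
      also have "\<dots> < d * M" using x M by (simp add: dist_padic_def)
      finally have 1: "padic_norm ((x - a) * y) < e" using dM by simp
      have "padic_norm (a * (y - b)) \<le> M * padic_norm (y - b)"
        unfolding padic_norm_mult using M by (intro mult_right_mono) auto
      also have "\<dots> < M * d" using y M by (simp add: dist_padic_def)
      finally have 2: "padic_norm (a * (y - b)) < e" using dM by (simp add: mult.commute)
      have "x * y - a * b = (x - a) * y + a * (y - b)" by (simp add: algebra_simps)
      then show "dist (fst (x, y) * snd (x, y)) (a * b) < e"
        using 1 2 padic_norm_ultrametric[of "(x - a) * y" "a * (y - b)"]
        by (simp add: dist_padic_def)
    qed
  qed
qed

lemma minus_Padic:
  assumes "padic_cauchy CARD('p::prime_card) X" "padic_cauchy CARD('p) Y"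
  shows "Padic X - Padic Y = (Padic (\<lambda>n. X n - Y n) :: 'p padic)"
proof -
  have "- (Padic Y :: 'p padic) = Padic (\<lambda>n. - Y n)"
    by (rule uminus_padic.abs_eq; intro padic_rel_refl assms)
  moreover have "Padic X + Padic (\<lambda>n. - Y n) = (Padic (\<lambda>n. X n + - Y n) :: 'p padic)"
    by (rule plus_padic.abs_eq; intro padic_rel_refl assms padic_cauchy_minus[OF prime_card])
  ultimately show ?thesis by (simp add: minus_padic_def)
qed

abbreviation padic_of_rat :: "rat \<Rightarrow> 'p::prime_card padic" where
  "padic_of_rat q \<equiv> Padic (\<lambda>_. q)"

lemma padic_norm_padic_of_rat_diff:
  "padic_norm (padic_of_rat q - padic_of_rat r :: 'p::prime_card padic) = padic_abs CARD('p) (q - r)"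
  using padic_norm_tendsto[OF padic_cauchy_const, where 'p='p, of "q - r"]
  by (simp add: minus_Padic LIMSEQ_const_iff)

lemma tendsto_padic_of_rat:
  assumes X: "padic_cauchy CARD('p::prime_card) X"
  shows "(\<lambda>N. padic_of_rat (X N)) \<longlonglongrightarrow> (Padic X :: 'p padic)"
  unfolding tendsto_iff eventually_sequentially
proof (intro allI impI)
  fix e :: real assume e: "e > 0"
  then have "e / 2 > 0" by simp
  then obtain N where N: "\<And>m n. m \<ge> N \<Longrightarrow> n \<ge> N \<Longrightarrow> padic_abs CARD('p) (X m - X n) < e / 2"
    using X unfolding padic_cauchy_def by blast
  have "dist (padic_of_rat (X n)) (Padic X :: 'p padic) < e" if n: "n \<ge> N" for n
  proof -
    have c: "padic_cauchy CARD('p) (\<lambda>m. X n - X m)"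
      using padic_cauchy_add[OF prime_card padic_cauchy_const padic_cauchy_minus[OF prime_card X], of "X n"]
      by simp
    have "padic_norm (padic_of_rat (X n) - Padic X :: 'p padic) \<le> e / 2"
      unfolding minus_Padic[OF padic_cauchy_const X]
      by (rule LIMSEQ_le_const2[OF padic_norm_tendsto[OF c]]) (use N n in \<open>force intro: less_imp_le\<close>)
    then show ?thesis using e by (simp add: dist_padic_def)
  qed
  then show "\<exists>N. \<forall>n\<ge>N. dist (padic_of_rat (X n)) (Padic X :: 'p padic) < e" by blast
qed

lemma padic_of_rat_dense:
  assumes "e > 0"
  shows "\<exists>q. dist x (padic_of_rat q :: 'p::prime_card padic) < e"
proof (induct x rule: padic_of_seq_induct)
  case (Padic X)
  have "eventually (\<lambda>N. dist (padic_of_rat (X N)) (Padic X :: 'p padic) < e) sequentially"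
    using tendsto_padic_of_rat[OF Padic] assms by (rule tendstoD)
  then show ?case by (auto simp: eventually_sequentially dist_commute)
qed

text \<open>
  Approximating the \<open>n\<close>-th member of a Cauchy sequence by a rational number with error below
  \<open>1 / (n + 1)\<close> gives a Cauchy sequence of rationals; the element it represents is the limit.
\<close>

instance padic :: (prime_card) complete_space
proof
  fix X :: "nat \<Rightarrow> 'a padic" assume X: "Cauchy X"
  have "\<forall>n. \<exists>q. dist (X n) (padic_of_rat q) < inverse (real (Suc n))"
    by (intro allI padic_of_rat_dense) simp
  from choice[OF this] obtain q where q: "\<And>n. dist (X n) (padic_of_rat (q n)) < inverse (real (Suc n))"
    by blast
  have d0: "(\<lambda>n. dist (padic_of_rat (q n)) (X n)) \<longlonglongrightarrow> 0"
    by (rule tendsto_sandwich[OF _ _ tendsto_const LIMSEQ_inverse_real_of_nat])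
       (use q in \<open>auto simp: dist_commute intro!: always_eventually less_imp_le\<close>)
  have "Cauchy (\<lambda>n. padic_of_rat (q n) :: 'a padic)"
    unfolding Cauchy_def
  proof (intro allI impI)
    fix e :: real assume e: "e > 0"
    then have e3: "e / 3 > 0" by simp
    obtain M where M: "\<And>m n. m \<ge> M \<Longrightarrow> n \<ge> M \<Longrightarrow> dist (X m) (X n) < e / 3"
      using X e3 unfolding Cauchy_def by blast
    have "eventually (\<lambda>n. dist (padic_of_rat (q n)) (X n) < e / 3) sequentially"
      using order_tendstoD(2)[OF d0 e3] .
    then obtain N where N: "\<And>n. n \<ge> N \<Longrightarrow> dist (padic_of_rat (q n)) (X n) < e / 3"
      by (auto simp: eventually_sequentially)
    have "dist (padic_of_rat (q m)) (padic_of_rat (q n) :: 'a padic) < e"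
      if "m \<ge> max M N" "n \<ge> max M N" for m n
    proof -
      have "dist (padic_of_rat (q m)) (padic_of_rat (q n) :: 'a padic)
        \<le> dist (padic_of_rat (q m)) (X m) + (dist (X m) (X n) + dist (X n) (padic_of_rat (q n)))"
        using dist_triangle[of "padic_of_rat (q m)" "padic_of_rat (q n) :: 'a padic" "X m"]
          dist_triangle[of "X m" "padic_of_rat (q n)" "X n"] by linarith
      then show ?thesis using M[of m n] N[of m] N[of n] that by (simp add: dist_commute)
    qed
    then show "\<exists>N. \<forall>m\<ge>N. \<forall>n\<ge>N. dist (padic_of_rat (q m)) (padic_of_rat (q n) :: 'a padic) < e" by blast
  qed
  then have "padic_cauchy CARD('a) q"
    unfolding Cauchy_def padic_cauchy_def dist_padic_def padic_norm_padic_of_rat_diff .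
  then have "(\<lambda>n. padic_of_rat (q n)) \<longlonglongrightarrow> (Padic q :: 'a padic)"
    by (rule tendsto_padic_of_rat)
  moreover have "(\<lambda>n. X n - padic_of_rat (q n)) \<longlonglongrightarrow> 0"
  proof -
    have "dist (X n - padic_of_rat (q n)) 0 = dist (padic_of_rat (q n)) (X n)" for n
      by (simp add: dist_padic_def padic_norm_diff_commute[of "X n"])
    then show ?thesis using d0 by (subst tendsto_dist_iff) simp
  qed
  ultimately have "(\<lambda>n. padic_of_rat (q n) + (X n - padic_of_rat (q n))) \<longlonglongrightarrow> Padic q + 0"
    by (rule tendsto_add)
  then have "X \<longlonglongrightarrow> Padic q" by simp
  then show "convergent X" by (rule convergentI)
qed

section \<open>Ultrametric series\<close>

lemma tendsto_padic_norm:
  fixes L :: "'p::prime_card padic"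
  assumes "(f \<longlongrightarrow> L) F"
  shows "((\<lambda>x. padic_norm (f x)) \<longlongrightarrow> padic_norm L) F"
proof -
  have "padic_norm x = dist x 0" for x :: "'p padic" by (simp add: dist_padic_def)
  then show ?thesis using tendsto_dist[OF assms tendsto_const] by simp
qed

lemma padic_norm_sum_le:
  fixes f :: "'a \<Rightarrow> 'p::prime_card padic"
  assumes "\<And>i. i \<in> A \<Longrightarrow> padic_norm (f i) \<le> B" "B \<ge> 0"
  shows "padic_norm (sum f A) \<le> B"
  using assms(1)
proof (induction A rule: infinite_finite_induct)
  case (insert i A)
  then show ?case
    by (auto intro: order.trans[OF padic_norm_ultrametric])
qed (use assms(2) in auto)

lemma padic_norm_power: "padic_norm (x ^ n) = padic_norm (x :: 'p::prime_card padic) ^ n"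
  by (induction n) (simp_all add: padic_norm_mult)

lemma padic_norm_divide: "padic_norm (x / y) = padic_norm x / padic_norm (y :: 'p::prime_card padic)"
proof (cases "y = 0")
  case False
  then have "padic_norm (x / y) * padic_norm y = padic_norm x" by (simp flip: padic_norm_mult)
  then show ?thesis using False by (simp add: field_simps)
qed simp

lemma padic_norm_of_nat_le: "padic_norm (of_nat k :: 'p::prime_card padic) \<le> 1"
proof (induction k)
  case (Suc k)
  then show ?case using padic_norm_ultrametric[of 1 "of_nat k :: 'p padic"] by simp
qed simp

lemma padic_norm_of_int_le: "padic_norm (of_int k :: 'p::prime_card padic) \<le> 1"
  by (cases k rule: int_cases2) (simp_all add: padic_norm_of_nat_le)

lemma padic_norm_prime: "padic_norm (of_nat CARD('p) :: 'p::prime_card padic) = 1 / real CARD('p)"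
proof -
  have "prime CARD('p)" by (rule prime_card)
  then show ?thesis
    using padic_abs_frac[of "CARD('p)" "int CARD('p)" 1]
    by (simp add: padic_norm_of_nat power_int_minus inverse_eq_divide)
qed

lemma padic_norm_le_limit:
  fixes L :: "'p::prime_card padic"
  assumes "X \<longlonglongrightarrow> L" "\<And>n. n \<ge> N \<Longrightarrow> padic_norm (X n) \<le> B"
  shows "padic_norm L \<le> B"
  by (rule LIMSEQ_le_const2[OF tendsto_padic_norm[OF assms(1)]]) (use assms(2) in blast)

lemma padic_summable_geometric:
  fixes u :: "nat \<Rightarrow> 'p::prime_card padic"
  assumes u: "\<And>k. padic_norm (u k) \<le> r ^ k" and r: "0 \<le> r" "r < 1"
  shows "summable u"
  unfolding summable_iff_convergent
proof (rule Cauchy_convergent, rule metric_CauchyI)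
  fix e :: real assume "e > 0"
  then obtain K where K: "r ^ K < e"
    using real_arch_pow_inv r(2) by blast
  have tail: "padic_norm (sum u {..<n} - sum u {..<K}) \<le> r ^ K" if "n \<ge> K" for n
  proof -
    have "sum u {..<n} - sum u {..<K} = sum u {K..<n}"
      using that by (simp add: lessThan_minus_lessThan flip: sum_diff)
    also have "padic_norm \<dots> \<le> r ^ K"
      using r by (intro padic_norm_sum_le order.trans[OF u] power_decreasing) auto
    finally show ?thesis .
  qed
  have "dist (sum u {..<m}) (sum u {..<n}) < e" if "m \<ge> K" "n \<ge> K" for m n
    using padic_norm_diff_le_max[of "sum u {..<m} - sum u {..<K}" "sum u {..<n} - sum u {..<K}"]
      tail[OF that(1)] tail[OF that(2)] K by (simp add: dist_padic_def)
  then show "\<exists>M. \<forall>m\<ge>M. \<forall>n\<ge>M. dist (sum u {..<m}) (sum u {..<n}) < e" by blast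
qed

lemma padic_norm_sums_tail:
  fixes u :: "nat \<Rightarrow> 'p::prime_card padic"
  assumes u: "\<And>k. padic_norm (u k) \<le> r ^ k" and r: "0 \<le> r" "r < 1" and S: "u sums S"
  shows "padic_norm (S - sum u {..<K}) \<le> r ^ K"
proof (rule padic_norm_le_limit)
  show "(\<lambda>n. sum u {..<n} - sum u {..<K}) \<longlonglongrightarrow> S - sum u {..<K}"
    using S unfolding sums_def by (intro tendsto_intros)
  fix n assume "n \<ge> K"
  then have "sum u {..<n} - sum u {..<K} = sum u {K..<n}"
    by (simp add: lessThan_minus_lessThan flip: sum_diff)
  also have "padic_norm \<dots> \<le> r ^ K"
    using r by (intro padic_norm_sum_le order.trans[OF u] power_decreasing) auto
  finally show "padic_norm (sum u {..<n} - sum u {..<K}) \<le> r ^ K" .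
qed

text \<open>
  Dominated convergence for series. The tails beyond \<open>K\<close> are at most \<open>r ^ K\<close> uniformly in \<open>s\<close>, by the
  ultrametric inequality, and the finitely many terms before \<open>K\<close> converge.
  It serves twice: for the Taylor series of the limit function, and for the convergence of the
  truncations to the hypergeometric series.
\<close>

lemma padic_dominated_sums:
  fixes u :: "nat \<Rightarrow> nat \<Rightarrow> 'p::prime_card padic"
  assumes lim: "\<And>k. (\<lambda>s. u s k) \<longlonglongrightarrow> v k"
    and u: "\<And>s k. padic_norm (u s k) \<le> r ^ k" and r: "0 \<le> r" "r < 1"
    and S: "\<And>s. u s sums S s"
  shows "summable v" "S \<longlonglongrightarrow> suminf v"
proof -
  have v: "padic_norm (v k) \<le> r ^ k" for k
    by (rule padic_norm_le_limit[OF lim]) (rule u)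
  then show sv: "summable v" using r by (rule padic_summable_geometric)
  show "S \<longlonglongrightarrow> suminf v"
    unfolding tendsto_iff
  proof (intro allI impI)
    fix e :: real assume "e > 0"
    then obtain K where K: "r ^ K < e"
      using real_arch_pow_inv r(2) by blast
    have "(\<lambda>s. sum (u s) {..<K}) \<longlonglongrightarrow> sum v {..<K}" by (intro tendsto_sum lim)
    then have "eventually (\<lambda>s. dist (sum (u s) {..<K}) (sum v {..<K}) < e) sequentially"
      using \<open>e > 0\<close> by (rule tendstoD)
    then show "eventually (\<lambda>s. dist (S s) (suminf v) < e) sequentially"
    proof eventually_elim
      case (elim s)
      have 1: "padic_norm (S s - sum (u s) {..<K}) < e"
        using padic_norm_sums_tail[where K = K, OF u r S, of s] K by (rule order.strict_trans1)
      have 2: "padic_norm (suminf v - sum v {..<K}) < e"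
        using padic_norm_sums_tail[where K = K, OF v r summable_sums[OF sv]] K by (rule order.strict_trans1)
      have "padic_norm ((S s - sum (u s) {..<K})
          + ((sum (u s) {..<K} - sum v {..<K}) - (suminf v - sum v {..<K}))) < e"
        by (rule padic_norm_add_less[OF 1 padic_norm_diff_less[OF elim[unfolded dist_padic_def] 2]])
      then show ?case by (simp add: dist_padic_def)
    qed
  qed
qed

text \<open>
  The product of the \<open>n\<close>-th partial sums differs from the \<open>n\<close>-th partial sum of the Cauchy product by the
  terms \<open>u i * v j\<close> with \<open>i, j < n \<le> i + j\<close>, each of norm at most \<open>r ^ n\<close>; so is their sum.
\<close>

lemma padic_cauchy_product_sums:
  fixes u v :: "nat \<Rightarrow> 'p::prime_card padic"
  assumes u: "\<And>k. padic_norm (u k) \<le> r ^ k" and v: "\<And>k. padic_norm (v k) \<le> r ^ k"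
    and r: "0 \<le> r" "r < 1" and S: "u sums S" and T: "v sums T"
  shows "(\<lambda>k. \<Sum>i\<le>k. u i * v (k - i)) sums (S * T)"
  unfolding sums_def
proof -
  \<comment> \<open>the part of the square of indices above the antidiagonal\<close>
  define E where "E n = sum u {..<n} * sum v {..<n} - (\<Sum>k<n. \<Sum>i\<le>k. u i * v (k - i))" for n
  have E: "padic_norm (E n) \<le> r ^ n" for n
  proof -
    have "(\<Sum>k<n. \<Sum>i\<le>k. u i * v (k - i)) = (\<Sum>(i, j)\<in>{(i, j). i + j < n}. u i * v j)"
      by (rule sum.triangle_reindex[symmetric])
    moreover have "sum u {..<n} * sum v {..<n} = (\<Sum>(i, j)\<in>{..<n} \<times> {..<n}. u i * v j)"
      by (simp add: sum_product sum.cartesian_product)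
    moreover have "{(i, j). i + j < n} \<subseteq> {..<n} \<times> {..<n}" by auto
    ultimately have "E n = (\<Sum>(i, j)\<in>{..<n} \<times> {..<n} - {(i, j). i + j < n}. u i * v j)"
      by (simp add: E_def sum_diff)
    also have "padic_norm \<dots> \<le> r ^ n"
    proof (rule padic_norm_sum_le)
      fix z assume "z \<in> {..<n} \<times> {..<n} - {(i, j). i + j < n}"
      then obtain i j where z: "z = (i, j)" "i + j \<ge> n" by auto
      have "padic_norm (u i * v j) \<le> r ^ i * r ^ j"
        unfolding padic_norm_mult using r by (intro mult_mono u v) auto
      also have "\<dots> \<le> r ^ n" using r z by (simp add: power_decreasing flip: power_add)
      finally show "padic_norm (case z of (i, j) \<Rightarrow> u i * v j) \<le> r ^ n" by (simp add: z)
    qed (use r in simp)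
    finally show ?thesis .
  qed
  have r0: "(\<lambda>n. r ^ n) \<longlonglongrightarrow> 0" using r by (intro LIMSEQ_realpow_zero)
  have "(\<lambda>n. padic_norm (E n)) \<longlonglongrightarrow> 0"
    by (rule tendsto_sandwich[OF _ _ tendsto_const r0]) (auto intro: always_eventually E)
  then have "E \<longlonglongrightarrow> 0"
    by (subst tendsto_dist_iff) (simp add: dist_padic_def)
  then have "(\<lambda>n. sum u {..<n} * sum v {..<n} - E n) \<longlonglongrightarrow> S * T - 0"
    using S T unfolding sums_def by (intro tendsto_diff tendsto_mult)
  then show "(\<lambda>n. \<Sum>k<n. \<Sum>i\<le>k. u i * v (k - i)) \<longlonglongrightarrow> S * T"
    by (simp add: E_def)
qed

section \<open>Power series expansions with integral coefficients\<close>

text \<open>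
  Functions on the open unit disc around \<open>a\<close> given by a power series with coefficients in the ring of
  \<open>p\<close>-adic integers. Integrality makes all these series converge on the whole disc, keeps the radius
  fixed under products, quotients and limits, and bounds the values by \<open>1\<close>.
\<close>

definition has_integral_expansion ::
    "('p::prime_card padic \<Rightarrow> 'p padic) \<Rightarrow> 'p padic fps \<Rightarrow> 'p padic \<Rightarrow> bool" where
  "has_integral_expansion g C a \<longleftrightarrow> (\<forall>k. padic_norm (fps_nth C k) \<le> 1) \<and>
     (\<forall>x\<in>ball a 1. (\<lambda>k. fps_nth C k * (x - a) ^ k) sums g x)"

definition integrally_analytic_at ::
    "('p::prime_card padic \<Rightarrow> 'p padic) \<Rightarrow> 'p padic \<Rightarrow> bool" where
  "integrally_analytic_at g a \<longleftrightarrow> (\<exists>C. has_integral_expansion g C a)"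

lemma has_integral_expansionI:
  assumes "\<And>k. padic_norm (fps_nth C k) \<le> 1"
    and "\<And>x. dist a x < 1 \<Longrightarrow> (\<lambda>k. fps_nth C k * (x - a) ^ k) sums g x"
  shows "has_integral_expansion g C a"
  using assms by (auto simp: has_integral_expansion_def)

lemma has_integral_expansionD:
  assumes "has_integral_expansion g C a"
  shows "padic_norm (fps_nth C k) \<le> 1"
    "dist a x < 1 \<Longrightarrow> (\<lambda>k. fps_nth C k * (x - a) ^ k) sums g x"
    "padic_norm (fps_nth C k * y ^ k) \<le> padic_norm y ^ k"
  using assms by (auto simp: has_integral_expansion_def padic_norm_mult padic_norm_power
      intro!: mult_left_le_one_le)

lemma has_integral_expansion_at_centre:
  assumes "has_integral_expansion g C a"
  shows "fps_nth C 0 = g a"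
proof -
  have "(\<lambda>k. fps_nth C k * (a - a) ^ k) sums g a"
    by (rule has_integral_expansionD[OF assms]) simp
  moreover have "(\<lambda>k. fps_nth C k * (a - a) ^ k) = (\<lambda>k. if k = 0 then fps_nth C k else 0)"
    by auto
  ultimately show ?thesis using sums_single[of 0 "fps_nth C"] by (metis sums_unique2)
qed

lemma has_integral_expansion_add:
  assumes "has_integral_expansion g C a" "has_integral_expansion h D a"
  shows "has_integral_expansion (\<lambda>x. g x + h x) (C + D) a"
proof (rule has_integral_expansionI)
  show "padic_norm (fps_nth (C + D) k) \<le> 1" for k
    using assms[THEN has_integral_expansionD(1), of k]
    by (auto intro: order.trans[OF padic_norm_ultrametric])
  show "(\<lambda>k. fps_nth (C + D) k * (x - a) ^ k) sums (g x + h x)" if "dist a x < 1" for x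
    using sums_add[OF assms[THEN has_integral_expansionD(2), OF that]]
    by (simp add: distrib_right)
qed

lemma has_integral_expansion_mult:
  assumes "has_integral_expansion g C a" "has_integral_expansion h D a"
  shows "has_integral_expansion (\<lambda>x. g x * h x) (C * D) a"
proof (rule has_integral_expansionI)
  show "padic_norm (fps_nth (C * D) k) \<le> 1" for k
    unfolding fps_mult_nth
    using assms[THEN has_integral_expansionD(1)]
    by (intro padic_norm_sum_le) (auto simp: padic_norm_mult intro: mult_le_one)
  fix x assume x: "dist a x < 1"
  have r: "padic_norm (x - a) < 1" using x by (simp add: dist_padic_def padic_norm_diff_commute)
  have "(\<lambda>k. \<Sum>i\<le>k. (fps_nth C i * (x - a) ^ i) * (fps_nth D (k - i) * (x - a) ^ (k - i))) sums (g x * h x)"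
    by (rule padic_cauchy_product_sums[OF _ _ padic_norm_nonneg r])
       (use assms x in \<open>auto intro: has_integral_expansionD\<close>)
  moreover have "(\<Sum>i\<le>k. (fps_nth C i * (x - a) ^ i) * (fps_nth D (k - i) * (x - a) ^ (k - i)))
     = fps_nth (C * D) k * (x - a) ^ k" for k
    unfolding fps_mult_nth sum_distrib_right atLeast0AtMost
  proof (intro sum.cong refl)
    fix i assume "i \<in> {..k}"
    then have "(x - a) ^ k = (x - a) ^ i * (x - a) ^ (k - i)" by (simp flip: power_add)
    then show "(fps_nth C i * (x - a) ^ i) * (fps_nth D (k - i) * (x - a) ^ (k - i))
      = fps_nth C i * fps_nth D (k - i) * (x - a) ^ k" by (simp only: mult_ac)
  qed
  ultimately show "(\<lambda>k. fps_nth (C * D) k * (x - a) ^ k) sums (g x * h x)" by simp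
qed

lemma has_integral_expansion_const:
  assumes "padic_norm c \<le> 1"
  shows "has_integral_expansion (\<lambda>_. c) (fps_const c) a"
proof (rule has_integral_expansionI)
  show "padic_norm (fps_nth (fps_const c) k) \<le> 1" for k
    using assms by simp
  fix x
  have "(\<lambda>k. fps_nth (fps_const c) k * (x - a) ^ k) = (\<lambda>k. if k = 0 then c else 0)"
    by auto
  then show "(\<lambda>k. fps_nth (fps_const c) k * (x - a) ^ k) sums c"
    using sums_single[of 0 "\<lambda>_. c"] by simp
qed

lemma has_integral_expansion_shift: "has_integral_expansion (\<lambda>x. x - a) fps_X a"
proof (rule has_integral_expansionI)
  show "padic_norm (fps_nth fps_X k :: 'a padic) \<le> 1" for k
    by (simp add: fps_X_def)
  fix x
  have "(\<lambda>k. fps_nth fps_X k * (x - a) ^ k) = (\<lambda>k. if k = 1 then x - a else 0)"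
    by (auto simp: fps_X_def)
  then show "(\<lambda>k. fps_nth fps_X k * (x - a) ^ k) sums (x - a)"
    using sums_single[of 1 "\<lambda>_. x - a"] by simp
qed

text \<open>
  Solving \<open>C * inverse C = 1\<close> recursively divides by the constant coefficient only, a unit.
\<close>

lemma fps_inverse_integral:
  fixes C :: "'p::prime_card padic fps"
  assumes C: "\<And>k. padic_norm (fps_nth C k) \<le> 1" and C0: "padic_norm (fps_nth C 0) = 1"
  shows "padic_norm (fps_nth (inverse C) n) \<le> 1"
proof (induction n rule: less_induct)
  case (less n)
  have nz: "fps_nth C 0 \<noteq> 0" using C0 by auto
  define w where "w = (\<Sum>i=1..n. fps_nth C i * fps_nth (inverse C) (n - i))"
  have "fps_nth (C * inverse C) n = fps_nth C 0 * fps_nth (inverse C) n + w"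
    unfolding fps_mult_nth w_def by (simp add: sum.atLeast_Suc_atMost)
  moreover have "C * inverse C = 1" using inverse_mult_eq_1[OF nz] by (simp add: mult.commute)
  ultimately have "fps_nth C 0 * fps_nth (inverse C) n = fps_nth 1 n - w" by simp
  then have "padic_norm (fps_nth (inverse C) n) = padic_norm (fps_nth 1 n - w)"
    using C0 padic_norm_mult[of "fps_nth C 0" "fps_nth (inverse C) n"] by simp
  also have "padic_norm w \<le> 1"
    unfolding w_def by (intro padic_norm_sum_le) (auto simp: padic_norm_mult intro!: mult_le_one C less)
  then have "padic_norm (fps_nth 1 n - w) \<le> 1"
    by (auto intro: order.trans[OF padic_norm_diff_le_max])
  finally show ?case .
qed

lemma integrally_analytic_at_mult:
  "integrally_analytic_at g a \<Longrightarrow> integrally_analytic_at h a \<Longrightarrow> integrally_analytic_at (\<lambda>x. g x * h x) a"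
  unfolding integrally_analytic_at_def using has_integral_expansion_mult by blast

lemma integrally_analytic_at_power:
  "integrally_analytic_at g a \<Longrightarrow> integrally_analytic_at (\<lambda>x. g x ^ n) a"
proof (induction n)
  case 0
  show ?case unfolding integrally_analytic_at_def
    using has_integral_expansion_const[of 1] by auto
next
  case (Suc n)
  then show ?case by (auto intro: integrally_analytic_at_mult)
qed

lemma integrally_analytic_at_ident:
  assumes "a \<in> padic_ints"
  shows "integrally_analytic_at (\<lambda>x. x) a"
proof -
  have "has_integral_expansion (\<lambda>x. a + (x - a)) (fps_const a + fps_X) a"
    using assms by (intro has_integral_expansion_add has_integral_expansion_const has_integral_expansion_shift)
      (simp add: padic_ints_def)
  then show ?thesis by (auto simp: integrally_analytic_at_def)
qed

lemma integrally_analytic_at_poly: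
  assumes g: "integrally_analytic_at g a"
  shows "integrally_analytic_at (\<lambda>x. poly (of_int_poly Q) (g x)) a"
proof (induction Q)
  case 0
  show ?case unfolding integrally_analytic_at_def
    using has_integral_expansion_const[of 0] by auto
next
  case (pCons c Q)
  obtain C where C: "has_integral_expansion (\<lambda>x. g x * poly (of_int_poly Q) (g x)) C a"
    using integrally_analytic_at_mult[OF g pCons.IH] by (auto simp: integrally_analytic_at_def)
  have "has_integral_expansion (\<lambda>x. of_int c + g x * poly (of_int_poly Q) (g x)) (fps_const (of_int c) + C) a"
    by (intro has_integral_expansion_add has_integral_expansion_const C padic_norm_of_int_le)
  then show ?case by (auto simp: integrally_analytic_at_def hom_distribs)
qed

text \<open>
  The formal inverse of the expansion is integral, hence converges on the disc to some function \<open>h\<close>. The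
  product of the two series is the series \<open>1\<close>, so \<open>h\<close> is the inverse of \<open>g\<close> pointwise.
\<close>

lemma integrally_analytic_at_inverse:
  assumes "integrally_analytic_at g a" "padic_norm (g a) = 1"
  shows "integrally_analytic_at (\<lambda>x. inverse (g x)) a"
proof -
  obtain C where C: "has_integral_expansion g C a" using assms(1) by (auto simp: integrally_analytic_at_def)
  have C0: "padic_norm (fps_nth C 0) = 1"
    using has_integral_expansion_at_centre[OF C] assms(2) by simp
  have D: "padic_norm (fps_nth (inverse C) k) \<le> 1" for k
    by (rule fps_inverse_integral[OF has_integral_expansionD(1)[OF C] C0])
  define h where "h x = (\<Sum>k. fps_nth (inverse C) k * (x - a) ^ k)" for x
  have h: "has_integral_expansion h (inverse C) a"
  proof (rule has_integral_expansionI)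
    fix x assume x: "dist a x < 1"
    have r: "padic_norm (x - a) < 1" using x by (simp add: dist_padic_def padic_norm_diff_commute)
    show "(\<lambda>k. fps_nth (inverse C) k * (x - a) ^ k) sums h x"
      unfolding h_def
      by (intro summable_sums padic_summable_geometric[OF _ padic_norm_nonneg r])
         (use D in \<open>auto simp: padic_norm_mult padic_norm_power intro!: mult_left_le_one_le\<close>)
  qed (rule D)
  have "fps_nth C 0 \<noteq> 0" using C0 by auto
  then have "C * inverse C = fps_const 1"
    using inverse_mult_eq_1[of C] by (simp add: mult.commute)
  then have gh: "has_integral_expansion (\<lambda>x. g x * h x) (fps_const 1) a"
    using has_integral_expansion_mult[OF C h] by simp
  have one: "has_integral_expansion (\<lambda>x. 1) (fps_const 1) a"
    by (rule has_integral_expansion_const) simp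
  have "h x = inverse (g x)" if "dist a x < 1" for x
  proof -
    have "g x * h x = 1"
      using has_integral_expansionD(2)[OF gh that] has_integral_expansionD(2)[OF one that]
      by (rule sums_unique2)
    then show ?thesis by (metis inverse_unique)
  qed
  then have "has_integral_expansion (\<lambda>x. inverse (g x)) (inverse C) a"
    using h by (auto simp: has_integral_expansion_def)
  then show ?thesis by (auto simp: integrally_analytic_at_def)
qed

text \<open>
  The coefficients of the expansions of \<open>g s\<close> change by multiples of \<open>p ^ (s + 1)\<close> from one step to the
  next, so they converge, and dominated convergence identifies the sum of the limit series with the
  limit of the functions.
\<close>

lemma integrally_analytic_at_limit:
  fixes f :: "'p::prime_card padic \<Rightarrow> 'p padic"
  assumes g0: "integrally_analytic_at (g 0) a"
    and h: "\<And>s. integrally_analytic_at (h s) a"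
    and step: "\<And>s x. dist a x < 1 \<Longrightarrow> g (Suc s) x = g s x + of_nat CARD('p) ^ Suc s * h s x"
    and lim: "\<And>x. dist a x < 1 \<Longrightarrow> (\<lambda>s. g s x) \<longlonglongrightarrow> f x"
  shows "integrally_analytic_at f a"
proof -
  define q :: "'p padic" where "q = of_nat CARD('p)"
  have q: "padic_norm q = 1 / real CARD('p)" unfolding q_def by (rule padic_norm_prime)
  have p1: "real CARD('p) > 1" using prime_gt_1_nat[OF prime_card[where 'a='p]] by simp
  have q1: "padic_norm q < 1" using q p1 by simp
  obtain C0 where C0: "has_integral_expansion (g 0) C0 a" using g0 by (auto simp: integrally_analytic_at_def)
  from h have "\<forall>s. \<exists>D. has_integral_expansion (h s) D a" by (auto simp: integrally_analytic_at_def)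
  from choice[OF this] obtain D where D: "\<And>s. has_integral_expansion (h s) (D s) a" by blast
  \<comment> \<open>the expansion of \<open>g s\<close>, telescoped\<close>
  define C where "C s = C0 + (\<Sum>i<s. fps_const (q ^ Suc i) * D i)" for s
  have C: "has_integral_expansion (g s) (C s) a" for s
  proof (induction s)
    case 0
    then show ?case using C0 by (simp add: C_def)
  next
    case (Suc s)
    have "padic_norm (q ^ Suc s) \<le> 1"
      unfolding padic_norm_power using q1 by (intro power_le_one) auto
    then have "has_integral_expansion (\<lambda>x. g s x + q ^ Suc s * h s x) (C s + fps_const (q ^ Suc s) * D s) a"
      by (intro has_integral_expansion_add has_integral_expansion_mult has_integral_expansion_const Suc D)
    moreover have "C (Suc s) = C s + fps_const (q ^ Suc s) * D s" by (simp add: C_def)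
    ultimately show ?case using step by (auto simp: has_integral_expansion_def q_def)
  qed
  have "summable (\<lambda>s. q ^ Suc s * fps_nth (D s) k)" for k
  proof (rule padic_summable_geometric[OF _ padic_norm_nonneg q1])
    fix s
    have "padic_norm q ^ Suc s \<le> padic_norm q ^ s" using q1 by (intro power_decreasing) auto
    moreover have "padic_norm q ^ Suc s * padic_norm (fps_nth (D s) k) \<le> padic_norm q ^ Suc s"
      using has_integral_expansionD(1)[OF D] by (intro mult_left_le) auto
    ultimately show "padic_norm (q ^ Suc s * fps_nth (D s) k) \<le> padic_norm q ^ s"
      unfolding padic_norm_mult padic_norm_power by linarith
  qed
  then have "(\<lambda>s. fps_nth (C s) k) \<longlonglongrightarrow> fps_nth C0 k + (\<Sum>s. q ^ Suc s * fps_nth (D s) k)" for k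
    unfolding C_def fps_add_nth fps_sum_nth fps_mult_left_const_nth
    by (intro tendsto_add tendsto_const summable_LIMSEQ)
  then have "\<forall>k. \<exists>c. (\<lambda>s. fps_nth (C s) k) \<longlonglongrightarrow> c" by blast
  from choice[OF this] obtain c where c: "\<And>k. (\<lambda>s. fps_nth (C s) k) \<longlonglongrightarrow> c k" by blast
  have "has_integral_expansion f (Abs_fps c) a"
  proof (rule has_integral_expansionI)
    show "padic_norm (fps_nth (Abs_fps c) k) \<le> 1" for k
      using padic_norm_le_limit[OF c[of k], of 0 1] has_integral_expansionD(1)[OF C] by simp
    fix x assume x: "dist a x < 1"
    have r: "padic_norm (x - a) < 1" using x by (simp add: dist_padic_def padic_norm_diff_commute)
    have lim': "(\<lambda>s. fps_nth (C s) k * (x - a) ^ k) \<longlonglongrightarrow> c k * (x - a) ^ k" for k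
      by (intro tendsto_mult c tendsto_const)
    have bound: "padic_norm (fps_nth (C s) k * (x - a) ^ k) \<le> padic_norm (x - a) ^ k" for s k
      by (rule has_integral_expansionD(3)[OF C])
    have sums: "(\<lambda>k. fps_nth (C s) k * (x - a) ^ k) sums g s x" for s
      by (rule has_integral_expansionD(2)[OF C x])
    note dom = padic_dominated_sums[where u = "\<lambda>s k. fps_nth (C s) k * (x - a) ^ k", OF lim' bound padic_norm_nonneg r sums]
    have "(\<Sum>k. c k * (x - a) ^ k) = f x"
      using dom(2) lim[OF x] by (rule LIMSEQ_unique)
    then show "(\<lambda>k. fps_nth (Abs_fps c) k * (x - a) ^ k) sums f x"
      using summable_sums[OF dom(1)] by simp
  qed
  then show ?thesis by (auto simp: integrally_analytic_at_def)
qed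

lemma padic_analytic_onI_integrally:
  assumes f: "\<And>a. a \<in> U \<Longrightarrow> integrally_analytic_at f a"
    and U: "\<And>a. a \<in> U \<Longrightarrow> ball a 1 \<subseteq> U"
  shows "padic_analytic_on f U"
  unfolding padic_analytic_on_def
proof
  fix a assume a: "a \<in> U"
  obtain C where "has_integral_expansion f C a" using f[OF a] by (auto simp: integrally_analytic_at_def)
  then have "\<forall>x\<in>ball a 1. (\<lambda>k. fps_nth C k * (x - a) ^ k) sums f x"
    by (simp add: has_integral_expansion_def)
  then show "\<exists>r>0. \<exists>c. ball a r \<subseteq> U \<and> (\<forall>x\<in>ball a r. (\<lambda>k. c k * (x - a) ^ k) sums f x)"
    using U[OF a] by (intro exI[of _ "1::real"] exI[of _ "fps_nth C"] conjI) auto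
qed

section \<open>The domain \<open>\<DD>\<close> and its stability under Frobenius\<close>

lemma prime_dvd_of_int_power_diff:
  assumes p: "prime p"
  shows "of_nat p dvd (of_int c :: 'a::comm_ring_1) ^ p - of_int c"
proof (induction c rule: int_induct[where k = 0])
  case base
  show ?case using p prime_gt_0_nat[OF p] by (simp add: power_0_left)
next
  case (step1 i)
  have "of_nat p dvd ((of_int i + 1) ^ p - (of_int i ^ p + 1 ^ p)) + ((of_int i :: 'a) ^ p - of_int i)"
    by (intro dvd_add prime_dvd_add_power_diff p step1)
  then show ?case by (simp add: algebra_simps)
next
  case (step2 i)
  have "of_nat p dvd ((of_int i :: 'a) ^ p - of_int i) - ((of_int (i - 1) + 1) ^ p - (of_int (i - 1) ^ p + 1 ^ p))"
    by (intro dvd_diff prime_dvd_add_power_diff p step2)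
  then show ?case by (simp add: algebra_simps)
qed

lemma int_poly_frobenius:
  fixes y :: "'a::comm_ring_1"
  assumes p: "prime p"
  shows "of_nat p dvd poly (of_int_poly Q) y ^ p - poly (of_int_poly Q) (y ^ p)"
proof (induction Q)
  case 0
  show ?case using prime_gt_0_nat[OF p] by (simp add: power_0_left)
next
  case (pCons c Q)
  let ?q = "poly (of_int_poly Q) :: 'a \<Rightarrow> 'a"
  have "of_nat p dvd ((of_int c + y * ?q y) ^ p - (of_int c ^ p + (y * ?q y) ^ p))
      + ((of_int c ^ p - of_int c) + y ^ p * (?q y ^ p - ?q (y ^ p)))"
    by (intro dvd_add dvd_mult prime_dvd_add_power_diff prime_dvd_of_int_power_diff p pCons.IH)
  moreover have "((of_int c + y * ?q y) ^ p - (of_int c ^ p + (y * ?q y) ^ p))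
      + ((of_int c ^ p - of_int c) + y ^ p * (?q y ^ p - ?q (y ^ p)))
      = (of_int c + y * ?q y) ^ p - (of_int c + y ^ p * ?q (y ^ p))"
    by (simp add: power_mult_distrib algebra_simps)
  ultimately show ?case by (simp add: hom_distribs)
qed

text \<open>
  As for the Dwork congruence, the congruence is made meaningful over a field by exhibiting
  the integral quotient.
\<close>

lemma int_poly_frobenius_eval:
  assumes p: "prime p"
  obtains R :: "int poly" where
    "\<And>x :: 'a::comm_ring_1. poly (of_int_poly Q) x ^ p - poly (of_int_poly Q) (x ^ p)
      = of_nat p * poly (of_int_poly R) x"
proof -
  obtain R :: "int poly" where R: "poly (of_int_poly Q) [:0, 1:] ^ p - poly (of_int_poly Q) ([:0, 1:] ^ p)
     = of_nat p * R"
    using int_poly_frobenius[OF p, of Q "[:0, 1:] :: int poly"] by (auto simp: dvd_def)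
  show ?thesis
  proof (rule that)
    fix x :: 'a
    define ev :: "int poly \<Rightarrow> 'a" where "ev Q = poly (of_int_poly Q) x" for Q
    interpret ev: comm_ring_hom ev
      by unfold_locales (auto simp: ev_def hom_distribs)
    have X: "ev [:0, 1:] = x" by (simp add: ev_def)
    have e: "ev (poly (of_int_poly S) Y) = poly (of_int_poly S) (ev Y)" for S Y
      by (induction S) (simp_all add: hom_distribs ev.hom_add ev.hom_mult)
    have "poly (of_int_poly Q) x ^ p - poly (of_int_poly Q) (x ^ p)
      = ev (poly (of_int_poly Q) [:0, 1:] ^ p - poly (of_int_poly Q) ([:0, 1:] ^ p))"
      by (simp only: ev.hom_minus ev.hom_power e X)
    also have "\<dots> = ev (of_nat p * R)" by (simp only: R)
    also have "\<dots> = of_nat p * poly (of_int_poly R) x"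
      by (simp only: ev.hom_mult ev.hom_of_nat) (simp only: ev_def)
    finally show "poly (of_int_poly Q) x ^ p - poly (of_int_poly Q) (x ^ p)
      = of_nat p * poly (of_int_poly R) x" .
  qed
qed

lemma padic_ints_power: "x \<in> padic_ints \<Longrightarrow> x ^ n \<in> padic_ints"
  by (auto simp: padic_ints_def padic_norm_power intro: power_le_one)

lemma padic_norm_int_poly_le:
  assumes "x \<in> padic_ints"
  shows "padic_norm (poly (of_int_poly Q) x) \<le> 1"
proof (induction Q)
  case 0
  show ?case by simp
next
  case (pCons c Q)
  have "padic_norm (x * poly (of_int_poly Q) x) \<le> 1"
    unfolding padic_norm_mult using assms pCons.IH by (intro mult_le_one) (auto simp: padic_ints_def)
  then show ?case
    by (auto simp: hom_distribs padic_norm_of_int_le intro: order.trans[OF padic_norm_ultrametric])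
qed

lemma padic_norm_int_poly_diff_le:
  assumes x: "x \<in> padic_ints" and y: "y \<in> padic_ints"
  shows "padic_norm (poly (of_int_poly Q) x - poly (of_int_poly Q) y) \<le> padic_norm (x - y)"
proof (induction Q)
  case 0
  show ?case by simp
next
  case (pCons c Q)
  let ?q = "poly (of_int_poly Q)"
  have 1: "padic_norm ((x - y) * ?q x) \<le> padic_norm (x - y)"
    unfolding padic_norm_mult using padic_norm_int_poly_le[OF x] by (intro mult_left_le) auto
  have "padic_norm (y * (?q x - ?q y)) \<le> padic_norm (?q x - ?q y)"
    unfolding padic_norm_mult using y by (intro mult_left_le_one_le) (auto simp: padic_ints_def)
  then have 2: "padic_norm (y * (?q x - ?q y)) \<le> padic_norm (x - y)" using pCons.IH by simp
  have "poly (of_int_poly (pCons c Q)) x - poly (of_int_poly (pCons c Q)) y = (x - y) * ?q x + y * (?q x - ?q y)"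
    by (simp add: hom_distribs algebra_simps)
  also have "padic_norm \<dots> \<le> padic_norm (x - y)"
    using 1 2 by (auto intro: order.trans[OF padic_norm_ultrametric])
  finally show ?case .
qed

lemma padic_norm_eq_if_close:
  fixes x y :: "'p::prime_card padic"
  assumes "padic_norm (x - y) < padic_norm y"
  shows "padic_norm x = padic_norm y"
proof (rule antisym)
  show "padic_norm x \<le> padic_norm y"
    using padic_norm_ultrametric[of "x - y" y] assms by simp
  show "padic_norm y \<le> padic_norm x"
    using padic_norm_diff_le_max[of x "x - y"] assms by (auto simp: max_def split: if_splits)
qed

lemma padic_norm_prime_mult_less:
  fixes z :: "'p::prime_card padic"
  assumes "padic_norm z \<le> 1"
  shows "padic_norm (of_nat CARD('p) * z) < 1"
proof -
  have "real CARD('p) > 1" using prime_gt_1_nat[OF prime_card[where 'a='p]] by simp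
  then show ?thesis using assms by (simp add: padic_norm_mult padic_norm_prime)
qed

lemma domD_subset_ints: "x \<in> domD \<Longrightarrow> x \<in> padic_ints"
  by (simp add: domD_def)

text \<open>
  Frobenius: \<open>Pbar p 1\<close> at \<open>x ^ p\<close> is congruent modulo \<open>p\<close> to the \<open>p\<close>-th power of its value at \<open>x\<close>, a unit.
\<close>

lemma domD_power_closed:
  fixes x :: "'p::prime_card padic"
  assumes "x \<in> domD"
  shows "x ^ CARD('p) \<in> domD"
proof -
  let ?P = "poly (Pbar CARD('p) 1) :: 'p padic \<Rightarrow> 'p padic"
  have x: "x \<in> padic_ints" "padic_norm (?P x) = 1" using assms by (auto simp: domD_def)
  obtain R where R: "\<And>x :: 'p padic. ?P x ^ CARD('p) - ?P (x ^ CARD('p)) = of_nat CARD('p) * poly (of_int_poly R) x"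
    by (rule int_poly_frobenius_eval[OF prime_card[where 'a='p], of "Pbar CARD('p) 1", unfolded of_int_poly_Pbar]) blast
  have "padic_norm (?P (x ^ CARD('p)) - ?P x ^ CARD('p)) < 1"
    unfolding padic_norm_diff_commute[of "?P (x ^ CARD('p))"] R
    by (intro padic_norm_prime_mult_less padic_norm_int_poly_le x)
  then have "padic_norm (?P (x ^ CARD('p))) = padic_norm (?P x ^ CARD('p))"
    by (intro padic_norm_eq_if_close) (simp only: padic_norm_power x power_one)
  then show ?thesis using x by (simp add: domD_def padic_norm_power padic_ints_power)
qed

text \<open>
  A polynomial with integer coefficients is \<open>1\<close>-Lipschitz on the \<open>p\<close>-adic integers, so its value is a unit
  either on all of an open unit disc or nowhere in it.
\<close>

lemma domD_ball_subset:
  assumes "a \<in> domD"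
  shows "ball a 1 \<subseteq> domD"
proof
  fix x assume "x \<in> ball a 1"
  then have xa: "padic_norm (x - a) < 1" by (simp add: dist_padic_def padic_norm_diff_commute)
  have a: "a \<in> padic_ints" "padic_norm (poly (Pbar CARD('a) 1) a) = 1" using assms by (auto simp: domD_def)
  have x: "x \<in> padic_ints"
    using padic_norm_ultrametric[of "x - a" a] xa a(1) by (simp add: padic_ints_def)
  have "padic_norm (poly (Pbar CARD('a) 1) x) = padic_norm (poly (Pbar CARD('a) 1) a)"
    using padic_norm_int_poly_diff_le[OF x a(1), of "Pbar CARD('a) 1"] xa a(2)
    by (intro padic_norm_eq_if_close) (simp add: of_int_poly_Pbar)
  then show "x \<in> domD" using x a by (simp add: domD_def)
qed

lemma D01_subset_domD: "D01 \<subseteq> domD"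
proof
  fix x :: "'a padic" assume x: "x \<in> D01"
  have "(0 :: 'a padic) \<in> domD" by (simp add: domD_def padic_ints_def poly_Pbar_0)
  moreover have "x \<in> ball 0 1" using x by (simp add: D01_def dist_padic_def)
  ultimately show "x \<in> domD" using domD_ball_subset by blast
qed

lemma D01_power_closed:
  assumes x: "x \<in> D01" and n: "n > 0"
  shows "x ^ n \<in> D01"
proof -
  have "padic_norm x ^ n \<le> padic_norm x ^ 1"
    using x n by (intro power_decreasing) (auto simp: D01_def)
  then have "padic_norm (x ^ n) < 1" using x by (simp add: D01_def padic_norm_power)
  then show ?thesis using x by (simp add: D01_def padic_ints_power)
qed

text \<open>
  Modulo \<open>p\<close> the Dwork congruence reads
  \<open>P (s + 2) x * P s (x ^ p) \<equiv> P (s + 1) x * P (s + 1) (x ^ p)\<close>. By induction the right-hand side and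
  the second factor on the left are units on the domain, hence so is \<open>P (s + 2) x\<close>.
\<close>

lemma padic_norm_Pbar_eq_1:
  fixes x :: "'p::prime_card padic"
  assumes odd: "odd CARD('p)" and "x \<in> domD"
  shows "padic_norm (poly (Pbar CARD('p) s) x) = 1"
proof -
  let ?p = "CARD('p)"
  let ?P = "\<lambda>s. poly (Pbar ?p s) :: 'p padic \<Rightarrow> 'p padic"
  have "\<forall>x\<in>domD. padic_norm (?P s x) = 1 \<and> padic_norm (?P (Suc s) x) = 1"
  proof (induction s)
    case 0
    show ?case by (simp add: domD_def)
  next
    case (Suc s)
    show ?case
    proof
      fix x :: "'p padic" assume x: "x \<in> domD"
      note xp = domD_power_closed[OF x]
      obtain R where R: "\<And>x :: 'p padic. ?P (Suc (Suc s)) x * ?P s (x ^ ?p) - ?P (Suc s) x * ?P (Suc s) (x ^ ?p)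
         = of_nat ?p ^ Suc s * poly (of_int_poly R) x"
        by (rule Pbar_dwork_congruence_eval[OF prime_card odd, of s]) blast
      have "padic_norm (of_nat ?p ^ s * poly (of_int_poly R) x) \<le> 1"
        unfolding padic_norm_mult padic_norm_power
        by (intro mult_le_one power_le_one padic_norm_int_poly_le padic_norm_of_nat_le
            zero_le_power padic_norm_nonneg domD_subset_ints[OF x])
      then have "padic_norm (of_nat ?p ^ Suc s * poly (of_int_poly R) x) < 1"
        unfolding power_Suc mult.assoc by (rule padic_norm_prime_mult_less)
      moreover have one: "padic_norm (?P (Suc s) x * ?P (Suc s) (x ^ ?p)) = 1"
        using Suc x xp by (simp add: padic_norm_mult)
      ultimately have "padic_norm (?P (Suc (Suc s)) x * ?P s (x ^ ?p)) = 1"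
        using padic_norm_eq_if_close[of "?P (Suc (Suc s)) x * ?P s (x ^ ?p)" "?P (Suc s) x * ?P (Suc s) (x ^ ?p)"]
        by (simp only: R)
      then have "padic_norm (?P (Suc (Suc s)) x) = 1"
        using Suc xp by (simp add: padic_norm_mult)
      then show "padic_norm (?P (Suc s) x) = 1 \<and> padic_norm (?P (Suc (Suc s)) x) = 1"
        using Suc x by blast
    qed
  qed
  then show ?thesis using assms by blast
qed

section \<open>Convergence of the truncations to the hypergeometric series\<close>

lemma half_exp_tendsto:
  assumes "odd CARD('p::prime_card)"
  shows "(\<lambda>s. of_nat (half_exp CARD('p) s) :: 'p padic) \<longlonglongrightarrow> - 1 / 2"
proof -
  let ?q = "of_nat CARD('p) :: 'p padic"
  have p1: "real CARD('p) > 1" using prime_gt_1_nat[OF prime_card[where 'a='p]] by simp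
  have "(\<lambda>s. (1 / real CARD('p)) ^ s) \<longlonglongrightarrow> 0" using p1 by (intro LIMSEQ_realpow_zero) auto
  then have "(\<lambda>s. ?q ^ s) \<longlonglongrightarrow> 0"
    by (subst tendsto_dist_iff) (simp add: dist_padic_def padic_norm_power padic_norm_prime)
  then have "(\<lambda>s. (?q ^ s - 1) * inverse 2) \<longlonglongrightarrow> (0 - 1) * inverse 2"
    by (intro tendsto_intros)
  moreover have "of_nat (half_exp CARD('p) s) = (?q ^ s - 1) * inverse 2" for s
  proof -
    have "CARD('p) ^ s \<ge> 1" by simp
    then have "(2 :: 'p padic) * of_nat (half_exp CARD('p) s) = ?q ^ s - 1"
      using arg_cong[OF half_exp(1)[OF assms, of s], of "of_nat :: nat \<Rightarrow> 'p padic"]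
      by (simp add: of_nat_diff)
    then show ?thesis by (simp add: field_simps)
  qed
  moreover have "(0 - 1) * inverse 2 = (- 1 / 2 :: 'p padic)" by simp
  ultimately show ?thesis by (simp only:)
qed

text \<open>
  \<open>(p ^ s - 1) / 2\<close> tends to \<open>-1/2\<close> in the \<open>p\<close>-adic numbers, and a binomial coefficient is a polynomial in
  its upper argument; so each coefficient of the truncation tends to the corresponding coefficient of the
  series. All coefficients of the truncations are integers, which gives the domination by
  \<open>padic_norm x ^ k\<close>.
\<close>

lemma Pbar_tendsto_hyperF:
  fixes x :: "'p::prime_card padic"
  assumes odd: "odd CARD('p)" and x: "x \<in> D01"
  shows "summable (\<lambda>k. ((- 1 / 2) gchoose k)\<^sup>2 * x ^ k)"
    and "(\<lambda>s. poly (Pbar CARD('p) s) x) \<longlonglongrightarrow> hyperF x"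
proof -
  define n where "n = half_exp CARD('p)"
  have nn: "(\<lambda>s. of_nat (n s) :: 'p padic) \<longlonglongrightarrow> - 1 / 2" unfolding n_def by (rule half_exp_tendsto[OF odd])
  have r: "padic_norm x < 1" using x by (simp add: D01_def)
  have lim: "(\<lambda>s. of_nat ((n s choose k)\<^sup>2) * x ^ k) \<longlonglongrightarrow> ((- 1 / 2) gchoose k)\<^sup>2 * x ^ k" for k
  proof -
    have "(\<lambda>s. (of_nat (n s) :: 'p padic) gchoose k) \<longlonglongrightarrow> (- 1 / 2) gchoose k"
      unfolding gbinomial_prod_rev divide_inverse
      by (intro tendsto_intros nn[unfolded divide_inverse])
    then show ?thesis
      unfolding of_nat_power binomial_gbinomial
      unfolding power2_eq_square
      by (intro tendsto_mult tendsto_const)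
  qed
  have bound: "padic_norm (of_nat ((n s choose k)\<^sup>2) * x ^ k) \<le> padic_norm x ^ k" for s k
    unfolding padic_norm_mult padic_norm_power
    by (intro mult_left_le_one_le padic_norm_of_nat_le) auto
  have sums: "(\<lambda>k. of_nat ((n s choose k)\<^sup>2) * x ^ k) sums poly (Pbar CARD('p) s) x" for s
    unfolding poly_Pbar n_def by (rule sums_finite) auto
  note dom = padic_dominated_sums[where u = "\<lambda>s k. of_nat ((n s choose k)\<^sup>2) * x ^ k",
      OF lim bound padic_norm_nonneg r sums]
  show "summable (\<lambda>k. ((- 1 / 2) gchoose k)\<^sup>2 * x ^ k)" by (rule dom(1))
  show "(\<lambda>s. poly (Pbar CARD('p) s) x) \<longlonglongrightarrow> hyperF x"
    unfolding hyperF_def by (rule dom(2))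
qed

lemma padic_norm_hyperF:
  fixes x :: "'p::prime_card padic"
  assumes odd: "odd CARD('p)" and x: "x \<in> D01"
  shows "padic_norm (hyperF x) = 1"
proof -
  have "x \<in> domD" using x D01_subset_domD by blast
  then show ?thesis
    using tendsto_padic_norm[OF Pbar_tendsto_hyperF(2)[OF odd x]]
    by (simp add: padic_norm_Pbar_eq_1[OF odd] LIMSEQ_const_iff)
qed

section \<open>The limit of the ratios\<close>

theorem theorem4p5:
  fixes p :: nat
  assumes "p = CARD('p::prime_card)" and "odd p"
  shows "(\<forall>s\<ge>1. \<forall>x\<in>(domD :: 'p padic set). poly (Pbar p s) (x ^ p) \<noteq> 0) \<and>
    (\<exists>f :: 'p padic \<Rightarrow> 'p padic.
       uniform_limit domD (\<lambda>s x. poly (Pbar p (s + 1)) x / poly (Pbar p s) (x ^ p)) f sequentially \<and>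
       padic_analytic_on f domD \<and>
       (\<forall>x\<in>D01. summable (\<lambda>k. ((- 1 / 2) gchoose k)\<^sup>2 * x ^ k) \<and>
          hyperF (x ^ p) \<noteq> 0 \<and> f x = hyperF x / hyperF (x ^ p)) \<and>
       (\<forall>x\<in>domD. padic_norm (f x) = 1))"
proof -
  have odd: "odd CARD('p)" using assms by simp
  have p: "prime p" unfolding assms(1) by (rule prime_card)
  define r where "r = 1 / real p"
  have r: "0 \<le> r" "r < 1" using prime_gt_1_nat[OF p] by (auto simp: r_def)
  define P :: "nat \<Rightarrow> 'p padic \<Rightarrow> 'p padic" where "P s = poly (Pbar p s)" for s
  define g where "g s x = P (s + 1) x / P s (x ^ p)" for s x
  have unit: "padic_norm (P s x) = 1" if "x \<in> domD" for s x
    using padic_norm_Pbar_eq_1[OF odd that] unfolding P_def assms(1) .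
  have powD: "x ^ p \<in> domD" if "x \<in> domD" for x :: "'p padic"
    using domD_power_closed[OF that] unfolding assms(1) .
  have nz: "P s x \<noteq> 0" if "x \<in> domD" for s x
    using unit[OF that, of s] by auto

  have "\<forall>s. \<exists>R. \<forall>x :: 'p padic. P (Suc (Suc s)) x * P s (x ^ p) - P (Suc s) x * P (Suc s) (x ^ p)
         = of_nat p ^ Suc s * poly (of_int_poly R) x"
    unfolding P_def by (intro allI, rule Pbar_dwork_congruence_eval[OF p assms(2)]) blast
  from choice[OF this] obtain R where R: "\<And>s x. P (Suc (Suc s)) x * P s (x ^ p) - P (Suc s) x * P (Suc s) (x ^ p)
         = of_nat p ^ Suc s * poly (of_int_poly (R s)) x" by blast
  \<comment> \<open>the Dwork congruence divided by its denominators: consecutive ratios differ by \<open>p ^ (s + 1) * h s\<close>\<close>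
  define h where "h s x = poly (of_int_poly (R s)) x * inverse (P (Suc s) (x ^ p) * P s (x ^ p))" for s x
  have step: "g (Suc s) x = g s x + of_nat p ^ Suc s * h s x" if x: "x \<in> domD" for s x
  proof -
    have "g (Suc s) x - g s x = (P (Suc (Suc s)) x * P s (x ^ p) - P (Suc s) x * P (Suc s) (x ^ p))
        * inverse (P (Suc s) (x ^ p) * P s (x ^ p))"
      using nz[OF powD[OF x]] by (simp add: g_def field_simps)
    then show ?thesis unfolding R h_def by (simp only: mult.assoc) (simp add: algebra_simps)
  qed
  have h_le: "padic_norm (of_nat p ^ Suc s * h s x) \<le> r ^ Suc s" if x: "x \<in> domD" for s x
  proof -
    have "padic_norm (h s x) \<le> 1"
      using unit[OF powD[OF x]] padic_norm_int_poly_le[OF domD_subset_ints[OF x]]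
      by (simp add: h_def padic_norm_mult padic_norm_divide inverse_eq_divide)
    moreover have "padic_norm (of_nat p :: 'p padic) = r"
      unfolding r_def assms(1) by (rule padic_norm_prime)
    ultimately show ?thesis
      unfolding padic_norm_mult padic_norm_power using r by (simp add: mult_left_le)
  qed
  have g_diff: "padic_norm (g (s + t) x - g s x) \<le> r ^ Suc s" if x: "x \<in> domD" for s t x
  proof (induction t)
    case 0
    show ?case using r by simp
  next
    case (Suc t)
    have "padic_norm (of_nat p ^ Suc (s + t) * h (s + t) x) \<le> r ^ Suc s"
      using h_le[OF x, of "s + t"] r power_decreasing[of "Suc s" "Suc (s + t)" r] by linarith
    then have "padic_norm ((g (s + t) x - g s x) + of_nat p ^ Suc (s + t) * h (s + t) x) \<le> r ^ Suc s"
      using Suc by (intro order.trans[OF padic_norm_ultrametric]) simp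
    then show ?case using step[OF x, of "s + t"] by (simp add: algebra_simps)
  qed
  define f where "f x = lim (\<lambda>s. g s x)" for x
  have f: "(\<lambda>s. g s x) \<longlonglongrightarrow> f x" if x: "x \<in> domD" for x
  proof -
    have "Cauchy (\<lambda>s. g s x)"
    proof (rule metric_CauchyI)
      fix e :: real assume "e > 0"
      then obtain K where K: "r ^ K < e" using real_arch_pow_inv r(2) by blast
      have close: "padic_norm (g m x - g K x) < e" if "m \<ge> K" for m
      proof -
        have "r ^ Suc K \<le> r ^ K" using r by (intro power_decreasing) auto
        then show ?thesis using g_diff[OF x, of K "m - K"] that K by simp
      qed
      have "dist (g m x) (g n x) < e" if "m \<ge> K" "n \<ge> K" for m n
        using padic_norm_diff_less[OF close[OF that(1)] close[OF that(2)]]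
        by (simp add: dist_padic_def)
      then show "\<exists>M. \<forall>m\<ge>M. \<forall>n\<ge>M. dist (g m x) (g n x) < e" by blast
    qed
    then show ?thesis unfolding f_def using Cauchy_convergent convergent_LIMSEQ_iff by blast
  qed
  have f_close: "padic_norm (f x - g s x) \<le> r ^ Suc s" if x: "x \<in> domD" for x s
  proof (rule padic_norm_le_limit)
    show "(\<lambda>t. g (s + t) x - g s x) \<longlonglongrightarrow> f x - g s x"
      using LIMSEQ_ignore_initial_segment[OF f[OF x], of s]
      by (intro tendsto_diff tendsto_const) (simp add: add.commute)
  qed (rule g_diff[OF x])

  have uniform: "uniform_limit domD g f sequentially"
  proof (rule uniform_limitI)
    fix e :: real assume "e > 0"
    then obtain K where K: "r ^ K < e" using real_arch_pow_inv r(2) by blast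
    have "dist (g s x) (f x) < e" if "s \<ge> K" "x \<in> domD" for s x
    proof -
      have "r ^ Suc s \<le> r ^ K" using r that by (intro power_decreasing) auto
      then show ?thesis
        using f_close[OF that(2), of s] K by (simp add: dist_padic_def padic_norm_diff_commute[of "g s x"])
    qed
    then show "\<forall>\<^sub>F s in sequentially. \<forall>x\<in>domD. dist (g s x) (f x) < e"
      unfolding eventually_sequentially by blast
  qed

  have an_P: "integrally_analytic_at (\<lambda>x. P s (x ^ p)) a" "integrally_analytic_at (P s) a"
    if "a \<in> domD" for s a
    using integrally_analytic_at_poly[OF integrally_analytic_at_power[OF integrally_analytic_at_ident], of a "Pbar p s" p]
      integrally_analytic_at_poly[OF integrally_analytic_at_ident, of a "Pbar p s"] domD_subset_ints[OF that]
    by (simp_all add: of_int_poly_Pbar P_def)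
  have "integrally_analytic_at f a" if a: "a \<in> domD" for a
  proof (rule integrally_analytic_at_limit)
    have "integrally_analytic_at (\<lambda>x. P (Suc 0) x * inverse (P 0 (x ^ p))) a"
      by (intro integrally_analytic_at_mult integrally_analytic_at_inverse an_P a unit powD)
    then show "integrally_analytic_at (g 0) a" unfolding g_def[abs_def] divide_inverse by simp
    show "integrally_analytic_at (h s) a" for s
      unfolding h_def[abs_def]
      by (intro integrally_analytic_at_mult integrally_analytic_at_inverse an_P a
          integrally_analytic_at_poly integrally_analytic_at_ident domD_subset_ints)
         (simp add: padic_norm_mult unit[OF powD[OF a]])
    fix x assume "dist a x < 1"
    then have x: "x \<in> domD" using domD_ball_subset[OF a] by auto
    show "g (Suc s) x = g s x + of_nat CARD('p) ^ Suc s * h s x" for s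
      using step[OF x] assms(1) by simp
    show "(\<lambda>s. g s x) \<longlonglongrightarrow> f x" by (rule f[OF x])
  qed
  then have analytic: "padic_analytic_on f domD"
    by (rule padic_analytic_onI_integrally[OF _ domD_ball_subset])

  have norm_f: "padic_norm (f x) = 1" if x: "x \<in> domD" for x
  proof -
    have "padic_norm (g s x) = 1" for s
      using unit[OF x] unit[OF powD[OF x]] by (simp add: g_def padic_norm_divide)
    then show ?thesis using tendsto_padic_norm[OF f[OF x]] by (simp add: LIMSEQ_const_iff)
  qed

  have ratio: "hyperF (x ^ p) \<noteq> 0 \<and> f x = hyperF x / hyperF (x ^ p)" if x: "x \<in> D01" for x
  proof -
    have xD: "x \<in> domD" using x D01_subset_domD by blast
    have xp: "x ^ p \<in> D01" using D01_power_closed[OF x prime_gt_0_nat[OF p]] .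
    have F: "(\<lambda>s. P s y) \<longlonglongrightarrow> hyperF y" if "y \<in> D01" for y
      using Pbar_tendsto_hyperF(2)[OF odd that] unfolding P_def assms(1) .
    \<comment> \<open>\<open>P (s + 1) x\<close> has the limits \<open>f x * hyperF (x ^ p)\<close> and \<open>hyperF x\<close>\<close>
    have "(\<lambda>s. g s x * P s (x ^ p)) \<longlonglongrightarrow> f x * hyperF (x ^ p)"
      by (intro tendsto_mult f xD F xp)
    moreover have "g s x * P s (x ^ p) = P (Suc s) x" for s
      using nz[OF powD[OF xD], of s] by (simp add: g_def)
    ultimately have "(\<lambda>s. P (Suc s) x) \<longlonglongrightarrow> f x * hyperF (x ^ p)" by simp
    moreover have "(\<lambda>s. P (Suc s) x) \<longlonglongrightarrow> hyperF x"
      using F[OF x] by (rule LIMSEQ_Suc)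
    ultimately have "f x * hyperF (x ^ p) = hyperF x" by (rule LIMSEQ_unique)
    moreover have "hyperF (x ^ p) \<noteq> 0" using padic_norm_hyperF[OF odd xp] by auto
    ultimately show ?thesis by (simp add: field_simps)
  qed

  show ?thesis
  proof (intro conjI exI[of _ f] ballI allI impI)
    show "poly (Pbar p s) (x ^ p) \<noteq> 0" if "x \<in> (domD :: 'p padic set)" for s x
      using nz[OF powD[OF that]] by (simp add: P_def)
    show "uniform_limit domD (\<lambda>s x. poly (Pbar p (s + 1)) x / poly (Pbar p s) (x ^ p)) f sequentially"
    proof -
      have "g = (\<lambda>s x. poly (Pbar p (s + 1)) x / poly (Pbar p s) (x ^ p))"
        by (intro ext) (simp only: g_def P_def)
      then show ?thesis using uniform by (simp only:)
    qed
    show "padic_analytic_on f domD" by (rule analytic)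
    fix x :: "'p padic"
    show "padic_norm (f x) = 1" if "x \<in> domD" using that by (rule norm_f)
    assume x: "x \<in> D01"
    show "summable (\<lambda>k. ((- 1 / 2) gchoose k)\<^sup>2 * x ^ k)" using odd x by (rule Pbar_tendsto_hyperF(1))
    show "hyperF (x ^ p) \<noteq> 0" "f x = hyperF x / hyperF (x ^ p)" using ratio[OF x] by blast+
  qed
qed

end
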